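(* Let $n\ge1$ and let $\mathbf c=(c_1,\dots,c_n)$ be a weak composition (a sequence of nonnegative integers, regarded as an $\mathbb{N}$-vector with $c_i=0$ for $i>n$). Then the reduction of $\mathfrak{P}_{\mathbf c}$ modulo $\mathrm{QSym}_n^+$, i.e. the unique element of $\mathbb{Q}\{\mathbf x^{\mathbf d}:\mathbf d\in\mathrm{ABB}_n\}$ congruent to $\mathfrak{P}_{\mathbf c}$, equals $\mathfrak{P}_{\mathbf c}$ if $\mathbf c\in\mathrm{ABB}_n$ and $0$ if $\mathbf c\notin\mathrm{ABB}_n$.
   Context: Indexed forests: for finite $S\subset\mathbb{Z}_{\ge1}$ with maximal consecutive blocks $I_1<\cdots<I_k$, an indexed forest $F$ with support $S$ consists of plane binary trees $T_j$ with $|I_j|$ nodes, canonically labeled by $I_j$ in inorder. Missing children are leaves. $\rho_F(v)$ is the canonical label of the node reached from $v$ by following left children as long as possible. $\mathbf c(F)=(c_i)$ with $c_i=\#\{v:\rho_F(v)=i\}$; the map $F\mapsto\mathbf c(F)$ is a bijection from such forests onto $\mathbb{N}$-vectors, and $\mathfrak{P}_{\mathbf c}:=\mathfrak{P}_F$ for $\mathbf c(F)=\mathbf c$. Here $\mathfrak{P}_F=\sum_\kappa\prod_v x_{\kappa(v)}$ over $\kappa:\operatorname{IN}(F)\to\mathbb{Z}_{\ge1}$ with $\kappa(v)\le\rho_F(v)$, $\kappa(\text{left child of }u)\ge\kappa(u)$, and $\kappa(\text{right child of }u)>\kappa(u)$. $\mathrm{QSym}_n^+$ is the ideal of $\mathbb{Q}[x_1,\dots,x_n]$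 generated by the positive-degree quasisymmetric polynomials in $x_1,\dots,x_n$. $\mathrm{ABB}_n$ is the set of weak compositions $(c_1,\dots,c_n)$ with $\sum_{i=1}^{j}c_{n+1-i}\le j-1$ for $j=1,\dots,n$, and $\mathbf x^{\mathbf d}=\prod_i x_i^{d_i}$. By Aval–Bergeron–Bergeron, $\mathbb{Q}[x_1,\dots,x_n]=\mathbb{Q}\{\mathbf x^{\mathbf d}:\mathbf d\in\mathrm{ABB}_n\}\oplus\mathrm{QSym}_n^+$. *)

theory Defs
  imports Complex_Main "HOL-Library.Tree" "HOL-Library.Poly_Mapping" "HOL-Library.FuncSet"
begin

text \<open>
  Polynomials in the variables \<open>x\<^sub>1, x\<^sub>2, \<dots>\<close> over the rationals are finitely supported functions from
  exponent vectors to coefficients, with the convolution product of \<^theory>\<open>HOL-Library.Poly_Mapping\<close>.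
  Exponent vectors are indexed from 1; a weak composition \<open>(c\<^sub>1, \<dots>, c\<^sub>n)\<close> is an exponent vector
  whose support is contained in \<open>{1..n}\<close>.
\<close>

type_synonym expvec = "nat \<Rightarrow>\<^sub>0 nat"
type_synonym qpoly = "expvec \<Rightarrow>\<^sub>0 rat"

definition monomial :: "expvec \<Rightarrow> qpoly" where
  "monomial d = Poly_Mapping.single d 1"

definition X :: "nat \<Rightarrow> qpoly" where
  "X i = monomial (Poly_Mapping.single i 1)"

definition smult :: "rat \<Rightarrow> qpoly \<Rightarrow> qpoly" where
  "smult r p = Poly_Mapping.single 0 r * p"

global_interpretation qpoly: vector_space smult
  by unfold_locales
    (simp_all add: smult_def algebra_simps single_add mult_single flip: mult.assoc)

definition polys_upto :: "nat \<Rightarrow> qpoly set" where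
  "polys_upto n = {p. \<forall>m\<in>Poly_Mapping.keys p. Poly_Mapping.keys m \<subseteq> {1..n}}"

definition homogeneous :: "nat \<Rightarrow> qpoly \<Rightarrow> bool" where
  "homogeneous d p \<longleftrightarrow>
     (\<forall>m\<in>Poly_Mapping.keys p. (\<Sum>i\<in>Poly_Mapping.keys m. Poly_Mapping.lookup m i) = d)"


section \<open>Quasisymmetric polynomials\<close>

definition quasisymmetric :: "nat \<Rightarrow> qpoly \<Rightarrow> bool" where
  "quasisymmetric n p \<longleftrightarrow> p \<in> polys_upto n \<and>
     (\<forall>(k::nat) (a::nat \<Rightarrow> nat) (i::nat \<Rightarrow> nat) (j::nat \<Rightarrow> nat).
        (\<forall>r<k. a r > 0) \<longrightarrow>
        strict_mono_on {..<k} i \<longrightarrow> i ` {..<k} \<subseteq> {1..n} \<longrightarrow>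
        strict_mono_on {..<k} j \<longrightarrow> j ` {..<k} \<subseteq> {1..n} \<longrightarrow>
        Poly_Mapping.lookup p (\<Sum>r<k. Poly_Mapping.single (i r) (a r)) =
        Poly_Mapping.lookup p (\<Sum>r<k. Poly_Mapping.single (j r) (a r)))"

definition ideal_gen :: "qpoly set \<Rightarrow> qpoly set \<Rightarrow> qpoly set" where
  "ideal_gen R G = {(\<Sum>q\<in>A. h q * q) | A h. finite A \<and> A \<subseteq> G \<and> (\<forall>q\<in>A. h q \<in> R)}"

definition QSym_plus :: "nat \<Rightarrow> qpoly set" where
  "QSym_plus n =
     ideal_gen (polys_upto n) {q. quasisymmetric n q \<and> (\<exists>d>0. homogeneous d q)}"

definition ABB :: "nat \<Rightarrow> expvec set" where
  "ABB n = {c. Poly_Mapping.keys c \<subseteq> {1..n} \<and>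
     (\<forall>j\<in>{1..n}. (\<Sum>i=1..j. Poly_Mapping.lookup c (n + 1 - i)) \<le> j - 1)}"

definition is_reduction :: "nat \<Rightarrow> qpoly \<Rightarrow> qpoly \<Rightarrow> bool" where
  "is_reduction n p r \<longleftrightarrow> r \<in> qpoly.span (monomial ` ABB n) \<and> p - r \<in> QSym_plus n"

definition reduction :: "nat \<Rightarrow> qpoly \<Rightarrow> qpoly" where
  "reduction n p = (THE r. is_reduction n p r)"


section \<open>Indexed forests and forest polynomials\<close>

definition blocks :: "nat set \<Rightarrow> nat set set" where
  "blocks S = {{a..b} | a b. a \<le> b \<and> {a..b} \<subseteq> S \<and> a - 1 \<notin> S \<and> b + 1 \<notin> S}"

text \<open>
  A forest is the set of its trees, each tree carrying its canonical labels. Constructors \<^const>\<open>Node\<close>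
  are the (internal) nodes and \<^const>\<open>Leaf\<close> is a missing child. Canonical labels are distinct, so
  nodes are identified with their labels and \<open>IN(F)\<close> with the support.
\<close>

definition indexed_forest_on :: "nat set \<Rightarrow> nat tree set \<Rightarrow> bool" where
  "indexed_forest_on S F \<longleftrightarrow> finite S \<and> S \<subseteq> {1..} \<and>
     bij_betw set_tree F (blocks S) \<and>
     (\<forall>T\<in>F. inorder T = sorted_list_of_set (set_tree T))"

definition indexed_forest :: "nat tree set \<Rightarrow> bool" where
  "indexed_forest F \<longleftrightarrow> (\<exists>S. indexed_forest_on S F)"

definition IN :: "nat tree set \<Rightarrow> nat set" where
  "IN F = (\<Union>T\<in>F. set_tree T)"

definition left_child :: "nat tree set \<Rightarrow> nat \<Rightarrow> nat \<Rightarrow> bool" where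
  "left_child F u v \<longleftrightarrow>
     (\<exists>T\<in>F. \<exists>l r r'. Node (Node l v r) u r' \<in> subtrees T)"

definition right_child :: "nat tree set \<Rightarrow> nat \<Rightarrow> nat \<Rightarrow> bool" where
  "right_child F u v \<longleftrightarrow>
     (\<exists>T\<in>F. \<exists>l l' r. Node l u (Node l' v r) \<in> subtrees T)"

fun leftmost :: "nat tree \<Rightarrow> nat" where
  "leftmost Leaf = undefined"
| "leftmost (Node Leaf v r) = v"
| "leftmost (Node (Node l u r') v r) = leftmost (Node l u r')"

definition rho :: "nat tree set \<Rightarrow> nat \<Rightarrow> nat" where
  "rho F v = (THE i. \<exists>T\<in>F. \<exists>l r. Node l v r \<in> subtrees T \<and> i = leftmost (Node l v r))"

definition forest_code :: "nat tree set \<Rightarrow> nat \<Rightarrow> nat" where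
  "forest_code F i = card {v \<in> IN F. rho F v = i}"

definition forest_labelings :: "nat tree set \<Rightarrow> (nat \<Rightarrow> nat) set" where
  "forest_labelings F = {\<kappa> \<in> IN F \<rightarrow>\<^sub>E {1..}.
     (\<forall>v\<in>IN F. \<kappa> v \<le> rho F v) \<and>
     (\<forall>u v. left_child F u v \<longrightarrow> \<kappa> v \<ge> \<kappa> u) \<and>
     (\<forall>u v. right_child F u v \<longrightarrow> \<kappa> v > \<kappa> u)}"

definition forest_poly :: "nat tree set \<Rightarrow> qpoly" where
  "forest_poly F = (\<Sum>\<kappa>\<in>forest_labelings F. \<Prod>v\<in>IN F. X (\<kappa> v))"

definition forest_of :: "expvec \<Rightarrow> nat tree set" where
  "forest_of c = (THE F. indexed_forest F \<and> forest_code F = Poly_Mapping.lookup c)"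

definition forest_poly_code :: "expvec \<Rightarrow> qpoly" where
  "forest_poly_code c = forest_poly (forest_of c)"

end

theory Submission
  imports Defs
begin

text \<open>
  Let \<open>R\<^sub>i\<close> set \<open>x\<^sub>i = 0\<close> and shift down the later variables. The operators \<open>T\<^sub>i = (R\<^bsub>i+1\<^esub> - R\<^sub>i) / x\<^sub>i\<close> with
  \<open>1 \<le> i < n\<close> map the ideal for \<open>n\<close> variables to the one for \<open>n - 1\<close> variables and the span of the
  ABB monomials for \<open>n\<close> to the one for \<open>n - 1\<close>. By induction on \<open>n\<close>, a polynomial in both the ideal
  and the span is killed by all of them. Its coefficients are then unchanged when the last
  variable of a monomial is replaced by the next one, so \<open>c\<^sub>n = 0\<close> leaves only the constant
  term, which vanishes in the ideal. Hence reductions are unique.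

  Since \<open>\<kappa> \<le> \<rho>\<close>, the tail sums of an exponent of a forest polynomial are at most those of its code;
  hence it lies in the span of the ABB monomials if its code is in ABB. Otherwise some tree of the
  forest contains a label \<open>\<ge> n\<close>. Regard the bounds \<open>\<rho>(v)\<close> as flags on the nodes of this tree, and
  lift them to \<open>n\<close> one node at a time in inorder. The flag of a node with a right child is implied by
  those to its right; raising the flag of any other node by 1 changes the sum by a multiple of the
  same kind of sum for a smaller tree that still reaches \<open>n\<close>. Once all flags are lifted, the sum is
  quasisymmetric, so the polynomial of the tree lies in the ideal.

  That a code determines its forest follows by reading the code from right to left, which
  assembles the trees on a stack.
\<close>

abbreviation "lookup \<equiv> Poly_Mapping.lookup"
abbreviation "keys \<equiv> Poly_Mapping.keys"
abbreviation "single \<equiv> Poly_Mapping.single"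

subsection \<open>Renaming and killing variables\<close>

lemma poly_mapping_eq_sum_single: "(\<Sum>d\<in>keys p. single d (lookup p d)) = p"
proof (rule poly_mapping_eqI)
  fix e
  have "lookup (\<Sum>d\<in>keys p. single d (lookup p d)) e = (\<Sum>d\<in>keys p. if d = e then lookup p d else 0)"
    by (auto simp: lookup_sum lookup_single when_def intro!: sum.cong)
  also have "\<dots> = lookup p e"
    by (simp add: sum.delta in_keys_iff)
  finally show "lookup (\<Sum>d\<in>keys p. single d (lookup p d)) e = lookup p e" .
qed

lemma keys_plus_canonically_ordered:
  fixes a b :: "'a \<Rightarrow>\<^sub>0 'b::canonically_ordered_monoid_add"
  shows "keys (a + b) = keys a \<union> keys b"
  by (auto simp: in_keys_iff lookup_add)

definition reindex :: "('a \<Rightarrow> 'b) \<Rightarrow> ('a \<Rightarrow>\<^sub>0 'c) \<Rightarrow> ('b \<Rightarrow>\<^sub>0 'c::comm_monoid_add)" where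
  "reindex \<sigma> e = (\<Sum>j\<in>keys e. single (\<sigma> j) (lookup e j))"

lemma lookup_reindex:
  assumes "inj \<sigma>"
  shows "lookup (reindex \<sigma> e) (\<sigma> j) = lookup e j"
proof -
  have "lookup (reindex \<sigma> e) (\<sigma> j) = (\<Sum>i\<in>keys e. if i = j then lookup e i else 0)"
    using assms by (auto simp: reindex_def lookup_sum lookup_single when_def inj_eq intro!: sum.cong)
  also have "\<dots> = lookup e j"
    by (simp add: sum.delta in_keys_iff)
  finally show ?thesis .
qed

lemma lookup_reindex_notin_range: "j \<notin> range \<sigma> \<Longrightarrow> lookup (reindex \<sigma> e) j = 0"
  by (auto simp: reindex_def lookup_sum lookup_single when_def intro!: sum.neutral)

lemma keys_reindex:
  assumes "inj \<sigma>"
  shows "keys (reindex \<sigma> e) = \<sigma> ` keys e"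
proof (intro equalityI subsetI)
  fix j assume "j \<in> keys (reindex \<sigma> e)"
  then show "j \<in> \<sigma> ` keys e"
    using assms lookup_reindex_notin_range[of j \<sigma> e]
    by (cases "j \<in> range \<sigma>") (auto simp: in_keys_iff lookup_reindex)
qed (use assms in \<open>auto simp: in_keys_iff lookup_reindex\<close>)

lemma reindex_eqI:
  assumes "inj \<sigma>" "\<And>j. lookup d (\<sigma> j) = lookup e j" "\<And>j. j \<notin> range \<sigma> \<Longrightarrow> lookup d j = 0"
  shows "reindex \<sigma> e = d"
proof (rule poly_mapping_eqI)
  fix j show "lookup (reindex \<sigma> e) j = lookup d j"
    using assms by (cases "j \<in> range \<sigma>") (auto simp: lookup_reindex lookup_reindex_notin_range)
qed

lemma reindex_add:
  assumes "inj \<sigma>"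
  shows "reindex \<sigma> (a + b) = reindex \<sigma> a + reindex \<sigma> b"
  using assms
  by (intro reindex_eqI) (simp_all add: lookup_add lookup_reindex lookup_reindex_notin_range)

lemma reindex_0 [simp]: "reindex \<sigma> 0 = 0"
  by (simp add: reindex_def)

lemma reindex_single [simp]: "reindex \<sigma> (single j a) = single (\<sigma> j) a"
  by (cases "a = 0") (simp_all add: reindex_def)

lemma reindex_sum: "inj \<sigma> \<Longrightarrow> reindex \<sigma> (sum f A) = (\<Sum>x\<in>A. reindex \<sigma> (f x))"
  by (induction A rule: infinite_finite_induct) (simp_all add: reindex_add)

lemma inj_reindex: "inj \<sigma> \<Longrightarrow> inj (reindex \<sigma>)"
  by (rule injI, rule poly_mapping_eqI) (metis lookup_reindex)

lemma in_range_reindex_iff: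
  assumes "inj \<sigma>"
  shows "d \<in> range (reindex \<sigma>) \<longleftrightarrow> keys d \<subseteq> range \<sigma>"
proof
  assume "keys d \<subseteq> range \<sigma>"
  then have "reindex \<sigma> (Poly_Mapping.map_key \<sigma> d) = d"
    using assms by (intro reindex_eqI) (auto simp: map_key.rep_eq in_keys_iff)
  then show "d \<in> range (reindex \<sigma>)" by (metis rangeI)
qed (use assms in \<open>auto simp: keys_reindex\<close>)

text \<open>The substitution \<open>x\<^bsub>\<sigma> j\<^esub> \<mapsto> x\<^sub>j\<close>, with \<open>x\<^sub>i \<mapsto> 0\<close> for \<open>i\<close> outside the range of \<open>\<sigma>\<close>.\<close>

definition pullback ::
  "('a \<Rightarrow> 'b) \<Rightarrow> (('b \<Rightarrow>\<^sub>0 'c::comm_monoid_add) \<Rightarrow>\<^sub>0 'd::zero) \<Rightarrow> (('a \<Rightarrow>\<^sub>0 'c) \<Rightarrow>\<^sub>0 'd)"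
where
  "pullback \<sigma> p = Poly_Mapping.map_key (reindex \<sigma>) p"

lemma lookup_pullback: "inj \<sigma> \<Longrightarrow> lookup (pullback \<sigma> p) e = lookup p (reindex \<sigma> e)"
  by (simp add: pullback_def map_key.rep_eq inj_reindex)

lemma keys_pullback: "inj \<sigma> \<Longrightarrow> keys (pullback \<sigma> p) = reindex \<sigma> -` keys p"
  by (simp add: pullback_def keys_map_key inj_reindex)

lemma pullback_0: "inj \<sigma> \<Longrightarrow> pullback \<sigma> 0 = 0"
  by (simp add: pullback_def inj_reindex)

lemma pullback_add: "inj \<sigma> \<Longrightarrow> pullback \<sigma> (p + q) = pullback \<sigma> p + pullback \<sigma> q"
  by (simp add: pullback_def map_key_plus inj_reindex)

lemma pullback_sum: "inj \<sigma> \<Longrightarrow> pullback \<sigma> (sum f A) = (\<Sum>x\<in>A. pullback \<sigma> (f x))"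
  by (induction A rule: infinite_finite_induct) (simp_all add: pullback_add pullback_0)

lemma pullback_single_reindex: "inj \<sigma> \<Longrightarrow> pullback \<sigma> (single (reindex \<sigma> e) a) = single e a"
  by (simp add: pullback_def inj_reindex)

lemma pullback_single_eq_0: "inj \<sigma> \<Longrightarrow> \<not> keys d \<subseteq> range \<sigma> \<Longrightarrow> pullback \<sigma> (single d a) = 0"
  by (intro poly_mapping_eqI)
    (auto simp: lookup_pullback lookup_single when_def simp flip: in_range_reindex_iff)

lemma pullback_single_mult_single:
  fixes a b :: "'b \<Rightarrow>\<^sub>0 'c::canonically_ordered_monoid_add" and x y :: "'d::semiring_0"
  assumes "inj \<sigma>"
  shows "pullback \<sigma> (single a x * single b y) = pullback \<sigma> (single a x) * pullback \<sigma> (single b y)"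
proof (cases "keys a \<subseteq> range \<sigma> \<and> keys b \<subseteq> range \<sigma>")
  case True
  then obtain a' b' where "a = reindex \<sigma> a'" "b = reindex \<sigma> b'"
    using in_range_reindex_iff[OF assms] by blast
  with assms show ?thesis
    by (simp add: mult_single pullback_single_reindex flip: reindex_add)
next
  case False
  then have "\<not> keys (a + b) \<subseteq> range \<sigma>"
    by (simp add: keys_plus_canonically_ordered)
  then have "pullback \<sigma> (single a x * single b y) = 0"
    using assms by (simp add: mult_single pullback_single_eq_0)
  moreover have "pullback \<sigma> (single a x) = 0 \<or> pullback \<sigma> (single b y) = 0"
    using False assms pullback_single_eq_0 by blast
  ultimately show ?thesis by auto
qed

lemma pullback_mult:
  fixes p q :: "('b \<Rightarrow>\<^sub>0 'c::canonically_ordered_monoid_add) \<Rightarrow>\<^sub>0 'd::semiring_0"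
  assumes "inj \<sigma>"
  shows "pullback \<sigma> (p * q) = pullback \<sigma> p * pullback \<sigma> q"
proof -
  let ?P = "\<lambda>d. single d (lookup p d)" and ?Q = "\<lambda>d. single d (lookup q d)"
  have "pullback \<sigma> (p * q) = pullback \<sigma> ((\<Sum>d\<in>keys p. ?P d) * (\<Sum>e\<in>keys q. ?Q e))"
    by (simp only: poly_mapping_eq_sum_single)
  also have "\<dots> = (\<Sum>d\<in>keys p. pullback \<sigma> (?P d)) * (\<Sum>e\<in>keys q. pullback \<sigma> (?Q e))"
    using assms by (simp add: sum_product pullback_sum pullback_single_mult_single)
  also have "\<dots> = pullback \<sigma> p * pullback \<sigma> q"
    using assms by (simp add: poly_mapping_eq_sum_single flip: pullback_sum)
  finally show ?thesis .
qed

lemma pullback_1: "inj \<sigma> \<Longrightarrow> pullback \<sigma> 1 = 1"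
  by (metis pullback_single_reindex reindex_0 single_one)

lemma pullback_X: "inj \<sigma> \<Longrightarrow> pullback \<sigma> (X (\<sigma> j)) = X j"
  unfolding X_def monomial_def by (metis pullback_single_reindex reindex_single)

lemma pullback_X_notin_range: "inj \<sigma> \<Longrightarrow> j \<notin> range \<sigma> \<Longrightarrow> pullback \<sigma> (X j) = 0"
  unfolding X_def monomial_def by (rule pullback_single_eq_0) simp_all


subsection \<open>Degrees, variables, and the ideal\<close>

definition total_degree :: "('a \<Rightarrow>\<^sub>0 'b) \<Rightarrow> 'b::comm_monoid_add" where
  "total_degree m = (\<Sum>i\<in>keys m. lookup m i)"

lemma homogeneous_iff: "homogeneous d p \<longleftrightarrow> (\<forall>m\<in>keys p. total_degree m = d)"
  by (simp add: homogeneous_def total_degree_def)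

lemma total_degree_superset: "finite A \<Longrightarrow> keys m \<subseteq> A \<Longrightarrow> total_degree m = (\<Sum>i\<in>A. lookup m i)"
  unfolding total_degree_def by (rule sum.mono_neutral_left) (auto simp: in_keys_iff)

lemma total_degree_add: "total_degree (a + b) = total_degree a + total_degree b"
  using keys_add[of a b]
  by (simp add: total_degree_superset[of "keys a \<union> keys b"] lookup_add sum.distrib)

lemma total_degree_reindex: "inj \<sigma> \<Longrightarrow> total_degree (reindex \<sigma> e) = total_degree e"
  unfolding total_degree_def
  by (simp add: keys_reindex sum.reindex inj_on_subset lookup_reindex)

lemma homogeneous_mult: "homogeneous a p \<Longrightarrow> homogeneous b q \<Longrightarrow> homogeneous (a + b) (p * q)"
  using keys_mult[of p q] by (fastforce simp: homogeneous_iff total_degree_add)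

lemma homogeneous_sum: "(\<And>x. x \<in> A \<Longrightarrow> homogeneous d (f x)) \<Longrightarrow> homogeneous d (sum f A)"
  using keys_sum[of f A] by (fastforce simp: homogeneous_iff)

lemma homogeneous_X: "homogeneous 1 (X i)"
  by (simp add: homogeneous_iff X_def monomial_def total_degree_def)

lemma homogeneous_1: "homogeneous 0 1"
  by (simp add: homogeneous_iff total_degree_def)

lemma homogeneous_pullback: "inj \<sigma> \<Longrightarrow> homogeneous d q \<Longrightarrow> homogeneous d (pullback \<sigma> q)"
  by (auto simp: homogeneous_iff keys_pullback) (metis total_degree_reindex)

lemma polys_upto_0: "0 \<in> polys_upto n"
  by (simp add: polys_upto_def)

lemma polys_upto_1: "1 \<in> polys_upto n"
  by (simp add: polys_upto_def)

lemma polys_upto_X: "1 \<le> i \<Longrightarrow> i \<le> n \<Longrightarrow> X i \<in> polys_upto n"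
  by (simp add: polys_upto_def X_def monomial_def)

lemma polys_upto_add: "p \<in> polys_upto n \<Longrightarrow> q \<in> polys_upto n \<Longrightarrow> p + q \<in> polys_upto n"
  using keys_add[of p q] by (fastforce simp: polys_upto_def)

lemma polys_upto_uminus: "p \<in> polys_upto n \<Longrightarrow> - p \<in> polys_upto n"
  by (simp add: polys_upto_def)

lemma polys_upto_mult: "p \<in> polys_upto n \<Longrightarrow> q \<in> polys_upto n \<Longrightarrow> p * q \<in> polys_upto n"
  using keys_mult[of p q] by (fastforce simp: polys_upto_def keys_plus_canonically_ordered)

lemma polys_upto_sum: "(\<And>x. x \<in> A \<Longrightarrow> f x \<in> polys_upto n) \<Longrightarrow> sum f A \<in> polys_upto n"
  by (induction A rule: infinite_finite_induct) (auto simp: polys_upto_0 polys_upto_add)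

lemma polys_upto_prod: "(\<And>x. x \<in> A \<Longrightarrow> f x \<in> polys_upto n) \<Longrightarrow> prod f A \<in> polys_upto n"
  by (induction A rule: infinite_finite_induct) (auto simp: polys_upto_1 polys_upto_mult)

lemma ideal_gen_mult:
  assumes mult: "\<And>p q. p \<in> R \<Longrightarrow> q \<in> R \<Longrightarrow> p * q \<in> R" and "g \<in> R" "f \<in> ideal_gen R G"
  shows "g * f \<in> ideal_gen R G"
proof -
  from assms obtain A h where "finite A" "A \<subseteq> G" "\<forall>q\<in>A. h q \<in> R" "f = (\<Sum>q\<in>A. h q * q)"
    by (auto simp: ideal_gen_def)
  then show ?thesis
    unfolding ideal_gen_def using mult \<open>g \<in> R\<close>
    by (intro CollectI exI[of _ A] exI[of _ "\<lambda>q. g * h q"]) (simp add: sum_distrib_left mult.assoc)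
qed

lemma ideal_gen_add:
  assumes add: "\<And>p q. p \<in> R \<Longrightarrow> q \<in> R \<Longrightarrow> p + q \<in> R" and "0 \<in> R"
    and "f \<in> ideal_gen R G" "g \<in> ideal_gen R G"
  shows "f + g \<in> ideal_gen R G"
proof -
  from assms obtain A h where A: "finite A" "A \<subseteq> G" "\<forall>q\<in>A. h q \<in> R" "f = (\<Sum>q\<in>A. h q * q)"
    by (auto simp: ideal_gen_def)
  from assms obtain B k where B: "finite B" "B \<subseteq> G" "\<forall>q\<in>B. k q \<in> R" "g = (\<Sum>q\<in>B. k q * q)"
    by (auto simp: ideal_gen_def)
  let ?h = "\<lambda>q. if q \<in> A then h q else 0" and ?k = "\<lambda>q. if q \<in> B then k q else 0"
  have "f = (\<Sum>q\<in>A \<union> B. ?h q * q)"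
    unfolding A by (rule sum.mono_neutral_cong_left) (use A B in auto)
  moreover have "g = (\<Sum>q\<in>A \<union> B. ?k q * q)"
    unfolding B by (rule sum.mono_neutral_cong_left) (use A B in auto)
  ultimately have "f + g = (\<Sum>q\<in>A \<union> B. (?h q + ?k q) * q)"
    by (simp only: distrib_right sum.distrib)
  then show ?thesis
    unfolding ideal_gen_def using A B add \<open>0 \<in> R\<close>
    by (intro CollectI exI[of _ "A \<union> B"] exI[of _ "\<lambda>q. ?h q + ?k q"]) auto
qed

lemma QSym_plus_0: "0 \<in> QSym_plus n"
  unfolding QSym_plus_def ideal_gen_def by (intro CollectI exI[of _ "{}"]) simp

lemma QSym_plus_mult: "g \<in> polys_upto n \<Longrightarrow> f \<in> QSym_plus n \<Longrightarrow> g * f \<in> QSym_plus n"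
  unfolding QSym_plus_def by (rule ideal_gen_mult) (auto intro: polys_upto_mult)

lemma QSym_plus_add: "f \<in> QSym_plus n \<Longrightarrow> g \<in> QSym_plus n \<Longrightarrow> f + g \<in> QSym_plus n"
  unfolding QSym_plus_def by (rule ideal_gen_add) (auto intro: polys_upto_add polys_upto_0)

lemma QSym_plus_diff: "f \<in> QSym_plus n \<Longrightarrow> g \<in> QSym_plus n \<Longrightarrow> f - g \<in> QSym_plus n"
  using QSym_plus_add[of f n "(- 1) * g"] QSym_plus_mult[of "- 1" n g]
  by (simp add: polys_upto_1 polys_upto_uminus)

lemma QSym_plus_sum: "(\<And>x. x \<in> A \<Longrightarrow> f x \<in> QSym_plus n) \<Longrightarrow> sum f A \<in> QSym_plus n"
  by (induction A rule: infinite_finite_induct) (auto simp: QSym_plus_0 QSym_plus_add)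

lemma QSym_plus_generator:
  assumes "quasisymmetric n q" "homogeneous d q" "d > 0"
  shows "q \<in> QSym_plus n"
  unfolding QSym_plus_def ideal_gen_def using assms polys_upto_1
  by (intro CollectI exI[of _ "{q}"] exI[of _ "\<lambda>_. 1"]) auto

lemma QSym_plusE:
  assumes "f \<in> QSym_plus n"
  obtains A h where "f = (\<Sum>q\<in>A. h q * q)"
    "\<And>q. q \<in> A \<Longrightarrow> quasisymmetric n q \<and> (\<exists>d>0. homogeneous d q) \<and> h q \<in> polys_upto n"
  using assms by (auto simp: QSym_plus_def ideal_gen_def)

lemma lookup_mult_0:
  fixes p q :: "('a \<Rightarrow>\<^sub>0 'b::canonically_ordered_monoid_add) \<Rightarrow>\<^sub>0 'c::semiring_0"
  assumes "lookup q 0 = 0"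
  shows "lookup (p * q) 0 = 0"
proof (rule ccontr)
  assume "lookup (p * q) 0 \<noteq> 0"
  then obtain a b where b: "b \<in> keys q" and ab: "a + b = 0"
    using keys_mult[of p q] in_keys_iff[of 0 "p * q"] by fastforce
  have "keys b \<subseteq> keys (a + b)"
    by (simp add: keys_plus_canonically_ordered)
  with b assms show False
    by (simp add: ab in_keys_iff)
qed

lemma QSym_plus_constant_term:
  assumes "f \<in> QSym_plus n"
  shows "lookup f 0 = 0"
proof -
  obtain A h where f: "f = (\<Sum>q\<in>A. h q * q)"
    and A: "\<And>q. q \<in> A \<Longrightarrow> \<exists>d>0. homogeneous d q"
    using assms by (rule QSym_plusE) blast
  have "lookup q 0 = 0" if q: "q \<in> A" for q
  proof -
    obtain d where "d > 0" "\<forall>m\<in>keys q. total_degree m = d"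
      using A[OF q] by (auto simp: homogeneous_iff)
    moreover have "total_degree (0 :: expvec) = 0"
      by (simp add: total_degree_def)
    ultimately have "0 \<notin> keys q" by fastforce
    then show ?thesis by (simp add: in_keys_iff)
  qed
  then show ?thesis
    by (simp add: f lookup_sum lookup_mult_0)
qed

lemma span_monomials_iff: "p \<in> qpoly.span (monomial ` A) \<longleftrightarrow> keys p \<subseteq> A"
proof
  assume "p \<in> qpoly.span (monomial ` A)"
  then show "keys p \<subseteq> A"
  proof (induction rule: qpoly.span_induct_alt)
    case (step c x y)
    have "keys (smult c x) \<subseteq> keys x"
      using keys_mult[of "single 0 c" x] by (auto simp: smult_def split: if_splits)
    moreover have "keys x \<subseteq> A"
      using step by (auto simp: monomial_def)
    ultimately show ?case
      using keys_add[of "smult c x" y] step by blast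
  qed simp
next
  assume "keys p \<subseteq> A"
  have "single d (lookup p d) = smult (lookup p d) (monomial d)" for d
    by (simp add: smult_def monomial_def mult_single)
  then have "p = (\<Sum>d\<in>keys p. smult (lookup p d) (monomial d))"
    using poly_mapping_eq_sum_single[of p] by simp
  also have "\<dots> \<in> qpoly.span (monomial ` A)"
    using \<open>keys p \<subseteq> A\<close> by (intro qpoly.span_sum qpoly.span_scale qpoly.span_base) auto
  finally show "p \<in> qpoly.span (monomial ` A)" .
qed


subsection \<open>Trimming operators\<close>

definition gap :: "nat \<Rightarrow> nat \<Rightarrow> nat" where
  "gap i j = (if j < i then j else Suc j)"

lemma strict_mono_gap: "strict_mono (gap i)"
  by (auto simp: strict_mono_def gap_def)

lemma inj_gap [simp]: "inj (gap i)"
  by (simp add: strict_mono_gap strict_mono_imp_inj_on)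

lemma range_gap: "range (gap i) = - {i}"
proof -
  have "j \<in> range (gap i)" if "j \<noteq> i" for j
    using that by (intro range_eqI[of _ _ "if j < i then j else j - 1"]) (auto simp: gap_def)
  then show ?thesis by (auto simp: gap_def)
qed

lemma gap_image_subset_iff:
  assumes "1 \<le> i" "i \<le> n"
  shows "gap i ` A \<subseteq> {1..n} \<longleftrightarrow> A \<subseteq> {1..n-1}"
proof -
  have "gap i j \<in> {1..n} \<longleftrightarrow> j \<in> {1..n-1}" for j
    using assms by (auto simp: gap_def)
  then show ?thesis by blast
qed

lemma reindex_gap_Suc:
  assumes "lookup e i = 0"
  shows "reindex (gap (Suc i)) e = reindex (gap i) e"
proof (rule reindex_eqI)
  show "lookup (reindex (gap i) e) (gap (Suc i) j) = lookup e j" for j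
  proof (cases "j = i")
    case True
    have "i \<notin> range (gap i)" by (simp add: range_gap)
    with True show ?thesis
      using assms lookup_reindex_notin_range[of i "gap i" e] by (simp add: gap_def)
  next
    case False
    then have "gap (Suc i) j = gap i j" by (auto simp: gap_def)
    then show ?thesis by (simp add: lookup_reindex)
  qed
  show "lookup (reindex (gap i) e) j = 0" if "j \<notin> range (gap (Suc i))" for j
    using that assms lookup_reindex[of "gap i" e i] by (simp add: range_gap) (simp add: gap_def)
qed simp

lemma lookup_X_mult_add: "lookup (X i * p) (e + single i 1) = lookup p e"
proof -
  have "X i * p = X i * (\<Sum>d\<in>keys p. single d (lookup p d))"
    by (simp only: poly_mapping_eq_sum_single)
  then have "X i * p = (\<Sum>d\<in>keys p. single (d + single i 1) (lookup p d))"
    by (simp add: X_def monomial_def sum_distrib_left mult_single add.commute)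
  then have "lookup (X i * p) (e + single i 1) = (\<Sum>d\<in>keys p. if d = e then lookup p d else 0)"
    by (simp add: lookup_sum lookup_single when_def)
  then show ?thesis
    by (simp add: sum.delta in_keys_iff)
qed

lemma lookup_X_mult_eq_0:
  assumes "lookup e i = 0"
  shows "lookup (X i * p) e = 0"
proof (rule ccontr)
  assume "lookup (X i * p) e \<noteq> 0"
  then obtain d where "e = single i 1 + d"
    using keys_mult[of "X i" p] by (auto simp: in_keys_iff X_def monomial_def)
  with assms show False by (simp add: lookup_add)
qed

text \<open>
  \<open>pullback (gap i)\<close> sets \<open>x\<^sub>i = 0\<close> and shifts the later variables down. Reading off the coefficient
  at \<open>e + \<epsilon>\<^sub>i\<close> performs the division by \<open>x\<^sub>i\<close>.
\<close>

definition trim :: "nat \<Rightarrow> qpoly \<Rightarrow> qpoly" where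
  "trim i p =
     Poly_Mapping.map_key (\<lambda>e. e + single i 1) (pullback (gap (Suc i)) p - pullback (gap i) p)"

lemma lookup_trim:
  "lookup (trim i p) e =
     lookup (pullback (gap (Suc i)) p - pullback (gap i) p) (e + single i 1)"
  by (simp add: trim_def map_key.rep_eq inj_def)

lemma X_mult_trim: "X i * trim i p = pullback (gap (Suc i)) p - pullback (gap i) p"
proof (rule poly_mapping_eqI)
  fix e
  show "lookup (X i * trim i p) e = lookup (pullback (gap (Suc i)) p - pullback (gap i) p) e"
  proof (cases "lookup e i = 0")
    case True
    then show ?thesis
      by (simp add: lookup_X_mult_eq_0 lookup_minus lookup_pullback reindex_gap_Suc)
  next
    case False
    then have "(e - single i 1) + single i 1 = e"
      by (intro poly_mapping_eqI) (auto simp: lookup_add lookup_minus lookup_single when_def)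
    then show ?thesis
      by (metis lookup_X_mult_add lookup_trim)
  qed
qed

lemma X_neq_0: "X i \<noteq> 0"
  by (simp add: X_def monomial_def flip: keys_eq_empty)

lemma trim_mult:
  assumes "pullback (gap (Suc i)) q = pullback (gap i) q"
  shows "trim i (h * q) = trim i h * pullback (gap i) q"
proof -
  have "X i * trim i (h * q) = (pullback (gap (Suc i)) h - pullback (gap i) h) * pullback (gap i) q"
    by (simp add: X_mult_trim pullback_mult assms left_diff_distrib)
  also have "\<dots> = X i * (trim i h * pullback (gap i) q)"
    by (simp add: mult.assoc flip: X_mult_trim)
  finally show ?thesis
    using mult_left_cancel[OF X_neq_0] by blast
qed

lemma trim_sum: "trim i (sum f A) = (\<Sum>x\<in>A. trim i (f x))"
  by (rule poly_mapping_eqI)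
    (simp add: lookup_trim lookup_minus lookup_pullback lookup_sum sum_subtractf)

lemma keys_trimE:
  assumes "e \<in> keys (trim i p)"
  obtains j where "j = i \<or> j = Suc i" "reindex (gap j) (e + single i 1) \<in> keys p"
proof -
  have "lookup p (reindex (gap (Suc i)) (e + single i 1)) \<noteq> 0 \<or>
      lookup p (reindex (gap i) (e + single i 1)) \<noteq> 0"
    using assms by (auto simp: in_keys_iff lookup_trim lookup_minus lookup_pullback)
  then show thesis
    using that by (auto simp: in_keys_iff)
qed

lemma polys_upto_trim:
  assumes "p \<in> polys_upto n" "1 \<le> i" "i < n"
  shows "trim i p \<in> polys_upto (n - 1)"
proof -
  have "keys e \<subseteq> {1..n-1}" if e: "e \<in> keys (trim i p)" for e
  proof -
    obtain j where j: "j = i \<or> j = Suc i" "reindex (gap j) (e + single i 1) \<in> keys p"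
      using keys_trimE[OF e] .
    then have "gap j ` keys (e + single i 1) \<subseteq> {1..n}"
      using assms(1) by (auto simp: polys_upto_def simp flip: keys_reindex[OF inj_gap])
    then have "keys (e + single i 1) \<subseteq> {1..n-1}"
      using j(1) assms by (subst (asm) gap_image_subset_iff) auto
    then show ?thesis by (simp add: keys_plus_canonically_ordered)
  qed
  then show ?thesis by (simp add: polys_upto_def)
qed

lemma quasisymmetricD:
  fixes k :: nat and i j a :: "nat \<Rightarrow> nat"
  assumes "quasisymmetric n p" "\<And>r. r < k \<Longrightarrow> a r > 0"
    and "strict_mono_on {..<k} i" "i ` {..<k} \<subseteq> {1..n}"
    and "strict_mono_on {..<k} j" "j ` {..<k} \<subseteq> {1..n}"
  shows "lookup p (\<Sum>r<k. single (i r) (a r)) = lookup p (\<Sum>r<k. single (j r) (a r))"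
  using assms(1)[unfolded quasisymmetric_def, THEN conjunct2, rule_format, of k a i j] assms(2-6)
  by blast

lemma reindex_eq_sum_nth:
  fixes e :: "'a::linorder \<Rightarrow>\<^sub>0 'c::comm_monoid_add"
  defines "l \<equiv> sorted_list_of_set (keys e)"
  shows "reindex \<sigma> e = (\<Sum>r<card (keys e). single (\<sigma> (l ! r)) (lookup e (l ! r)))"
proof -
  have "bij_betw (\<lambda>r. l ! r) {..<card (keys e)} (keys e)"
    unfolding l_def by (rule bij_betw_nth) auto
  then show ?thesis
    unfolding reindex_def by (rule sum.reindex_bij_betw[symmetric])
qed

lemma quasisymmetric_reindex:
  fixes \<sigma> \<tau> :: "'a::linorder \<Rightarrow> nat"
  assumes "quasisymmetric n q" "strict_mono \<sigma>" "strict_mono \<tau>"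
    and "\<sigma> ` keys e \<subseteq> {1..n}" "\<tau> ` keys e \<subseteq> {1..n}"
  shows "lookup q (reindex \<sigma> e) = lookup q (reindex \<tau> e)"
proof -
  let ?l = "sorted_list_of_set (keys e)" and ?k = "card (keys e)"
  have nth_in_keys: "?l ! r \<in> keys e" if "r < ?k" for r
    using that nth_mem[of r ?l] by simp
  have mono: "strict_mono_on {..<?k} (\<lambda>r. \<rho> (?l ! r))" if "strict_mono \<rho>" for \<rho> :: "'a \<Rightarrow> nat"
    using that strict_sorted_list_of_set[of "keys e"]
    by (auto simp: strict_mono_on_def strict_mono_def sorted_wrt_iff_nth_less)
  have pos: "lookup e (?l ! r) > 0" if "r < ?k" for r
    using nth_in_keys[OF that] by (simp add: in_keys_iff)
  have "(\<lambda>r. \<sigma> (?l ! r)) ` {..<?k} \<subseteq> {1..n}" "(\<lambda>r. \<tau> (?l ! r)) ` {..<?k} \<subseteq> {1..n}"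
    using assms(4,5) nth_in_keys by blast+
  then show ?thesis
    unfolding reindex_eq_sum_nth[of _ e]
    by (intro quasisymmetricD[OF assms(1)] pos mono assms(2,3))
qed

lemma pullback_gap_Suc_quasisymmetric:
  assumes quasisym: "quasisymmetric n q" and "1 \<le> i" "i < n"
  shows "pullback (gap (Suc i)) q = pullback (gap i) q"
proof (rule poly_mapping_eqI)
  fix e
  have outside: "lookup q (reindex (gap j) e) = 0" if "\<not> keys e \<subseteq> {1..n-1}" "j = i \<or> j = Suc i" for j
  proof -
    have "\<not> keys (reindex (gap j) e) \<subseteq> {1..n}"
      using that assms(2,3) gap_image_subset_iff[of j n "keys e"] by (auto simp: keys_reindex)
    then show ?thesis
      using quasisym unfolding quasisymmetric_def polys_upto_def by (auto simp: in_keys_iff)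
  qed
  show "lookup (pullback (gap (Suc i)) q) e = lookup (pullback (gap i) q) e"
  proof (cases "keys e \<subseteq> {1..n-1}")
    case True
    then have "gap (Suc i) ` keys e \<subseteq> {1..n}" "gap i ` keys e \<subseteq> {1..n}"
      using assms by (simp_all add: gap_image_subset_iff del: One_nat_def)
    then show ?thesis
      by (simp add: lookup_pullback quasisymmetric_reindex[OF quasisym] strict_mono_gap)
  next
    case False
    then show ?thesis by (simp add: lookup_pullback outside)
  qed
qed

lemma quasisymmetric_pullback_gap:
  assumes quasisym: "quasisymmetric n q" and "1 \<le> i" "i \<le> n"
  shows "quasisymmetric (n - 1) (pullback (gap i) q)"
  unfolding quasisymmetric_def
proof (intro conjI allI impI)
  have "keys e \<subseteq> {1..n-1}" if "e \<in> keys (pullback (gap i) q)" for e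
  proof -
    have "gap i ` keys e \<subseteq> {1..n}"
      using that quasisym unfolding quasisymmetric_def polys_upto_def
      by (simp add: keys_pullback flip: keys_reindex)
    then show ?thesis
      using assms by (subst (asm) gap_image_subset_iff) auto
  qed
  then show "pullback (gap i) q \<in> polys_upto (n - 1)"
    by (simp add: polys_upto_def)
next
  fix k :: nat and a s t :: "nat \<Rightarrow> nat"
  assume pos: "\<forall>r<k. a r > (0::nat)"
    and mono_s: "strict_mono_on {..<k} s" "s ` {..<k} \<subseteq> {1..n-1}"
    and mono_t: "strict_mono_on {..<k} t" "t ` {..<k} \<subseteq> {1..n-1}"
  have mono_gap: "strict_mono_on {..<k} (\<lambda>r. gap i (u r))"
    if "strict_mono_on {..<k} u" for u :: "nat \<Rightarrow> nat"
    using that strict_mono_gap[of i] by (auto simp: strict_mono_on_def strict_mono_def)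
  have "(\<lambda>r. gap i (s r)) ` {..<k} \<subseteq> {1..n}" "(\<lambda>r. gap i (t r)) ` {..<k} \<subseteq> {1..n}"
    using mono_s(2) mono_t(2) assms
      gap_image_subset_iff[of i n "s ` {..<k}"] gap_image_subset_iff[of i n "t ` {..<k}"]
    by (simp_all add: image_image del: One_nat_def)
  then have "lookup q (\<Sum>r<k. single (gap i (s r)) (a r)) = lookup q (\<Sum>r<k. single (gap i (t r)) (a r))"
    using pos by (intro quasisymmetricD[OF quasisym] mono_gap mono_s(1) mono_t(1)) auto
  then show "lookup (pullback (gap i) q) (\<Sum>r<k. single (s r) (a r)) =
      lookup (pullback (gap i) q) (\<Sum>r<k. single (t r) (a r))"
    by (simp add: lookup_pullback reindex_sum)
qed

lemma QSym_plus_trim: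
  assumes "f \<in> QSym_plus n" "1 \<le> i" "i < n"
  shows "trim i f \<in> QSym_plus (n - 1)"
proof -
  obtain A h where f: "f = (\<Sum>q\<in>A. h q * q)"
    and A: "\<And>q. q \<in> A \<Longrightarrow> quasisymmetric n q \<and> (\<exists>d>0. homogeneous d q) \<and> h q \<in> polys_upto n"
    using QSym_plusE[OF assms(1)] by blast
  have "trim i (h q * q) \<in> QSym_plus (n - 1)" if "q \<in> A" for q
  proof -
    from A[OF that]
    obtain d where q: "quasisymmetric n q" "d > 0" "homogeneous d q" and "h q \<in> polys_upto n"
      by blast
    have "pullback (gap i) q \<in> QSym_plus (n - 1)"
      using quasisymmetric_pullback_gap[OF q(1) \<open>1 \<le> i\<close>] homogeneous_pullback[OF inj_gap q(3)]
        q(2) \<open>i < n\<close>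
      by (intro QSym_plus_generator[of _ _ d]) auto
    moreover have "trim i (h q) \<in> polys_upto (n - 1)"
      using \<open>h q \<in> polys_upto n\<close> assms(2,3) by (rule polys_upto_trim)
    moreover have "trim i (h q * q) = trim i (h q) * pullback (gap i) q"
      using pullback_gap_Suc_quasisymmetric[OF q(1) assms(2,3)] by (rule trim_mult)
    ultimately show ?thesis by (simp add: QSym_plus_mult)
  qed
  then show ?thesis by (simp add: f trim_sum QSym_plus_sum)
qed


subsection \<open>Uniqueness of the reduction\<close>

lemma ABB_iff:
  "c \<in> ABB n \<longleftrightarrow> keys c \<subseteq> {1..n} \<and> (\<forall>m\<in>{1..n}. (\<Sum>j=m..n. lookup c j) \<le> n - m)"
proof -
  have "(\<Sum>i=1..j. lookup c (n + 1 - i)) = (\<Sum>i=n+1-j..n. lookup c i)" if "j \<in> {1..n}" for j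
    using that
    by (intro sum.reindex_bij_witness[of _ "\<lambda>i. n + 1 - i" "\<lambda>i. n + 1 - i"]) auto
  then have "(\<forall>j\<in>{1..n}. (\<Sum>i=1..j. lookup c (n + 1 - i)) \<le> j - 1) \<longleftrightarrow>
      (\<forall>j\<in>{1..n}. (\<Sum>i=n+1-j..n. lookup c i) \<le> n - (n + 1 - j))"
    by (intro ball_cong) auto
  also have "\<dots> \<longleftrightarrow> (\<forall>m\<in>(\<lambda>j. n + 1 - j) ` {1..n}. (\<Sum>j=m..n. lookup c j) \<le> n - m)"
    by simp
  also have "(\<lambda>j. n + 1 - j) ` {1..n} = {1..n}"
    by (intro endo_inj_surj inj_onI) auto
  finally show ?thesis by (simp add: ABB_def)
qed

lemma ABB_trim:
  assumes ABB: "reindex (gap t) (e + single i 1) \<in> ABB n"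
    and t_cases: "t = i \<or> t = Suc i" and i_bounds: "1 \<le> i" "i < n"
  shows "e \<in> ABB (n - 1)"
  unfolding ABB_iff
proof (intro conjI ballI)
  let ?d = "reindex (gap t) (e + single i 1)"
  have "gap t ` keys (e + single i 1) \<subseteq> {1..n}"
    using ABB by (simp add: ABB_iff keys_reindex)
  then have "keys (e + single i 1) \<subseteq> {1..n-1}"
    using t_cases i_bounds by (subst (asm) gap_image_subset_iff) auto
  then show "keys e \<subseteq> {1..n-1}"
    by (simp add: keys_plus_canonically_ordered)
  fix m assume m: "m \<in> {1..n-1}"
  have "(\<Sum>j=m..n-1. lookup e j) + (if m \<le> i then 1 else 0) = (\<Sum>j=m..n-1. lookup (e + single i 1) j)"
    using i_bounds by (auto simp: lookup_add lookup_single when_def sum.distrib sum.delta)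
  also have "\<dots> = (\<Sum>j=m..n-1. lookup ?d (gap t j))"
    by (simp add: lookup_reindex)
  also have "\<dots> = (\<Sum>j\<in>gap t ` {m..n-1}. lookup ?d j)"
    by (simp add: sum.reindex inj_on_subset[OF inj_gap])
  also have "\<dots> \<le> (\<Sum>j=gap (Suc i) m..n. lookup ?d j)"
    using t_cases i_bounds by (intro sum_mono2) (auto simp: gap_def)
  also have "\<dots> \<le> n - gap (Suc i) m"
  proof -
    have "gap (Suc i) m \<in> {1..n}"
      using m i_bounds by (auto simp: gap_def)
    then show ?thesis
      using ABB unfolding ABB_iff by blast
  qed
  finally show "(\<Sum>j=m..n-1. lookup e j) \<le> n - 1 - m"
    using m by (auto simp: gap_def split: if_splits)
qed

lemma keys_subset_0_if_gap_invariant: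
  assumes ABB: "keys r \<subseteq> ABB n"
    and invariant: "\<And>i. 1 \<le> i \<Longrightarrow> i < n \<Longrightarrow> pullback (gap (Suc i)) r = pullback (gap i) r"
  shows "keys r \<subseteq> {0}"
proof (rule ccontr)
  assume "\<not> keys r \<subseteq> {0}"
  then have "Max ((\<lambda>d. Max (keys d)) ` (keys r - {0})) \<in> (\<lambda>d. Max (keys d)) ` (keys r - {0})"
    by (intro Max_in) auto
  then obtain d where d: "d \<in> keys r" "d \<noteq> 0"
    and "Max ((\<lambda>d. Max (keys d)) ` (keys r - {0})) = Max (keys d)"
    by auto
  then have max: "Max (keys d') \<le> Max (keys d)" if "d' \<in> keys r - {0}" for d'
    using that by (metis Max_ge finite_Diff finite_imageI finite_keys imageI)
  define k where "k = Max (keys d)"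
  have k: "k \<in> keys d"
    unfolding k_def using d(2) by (intro Max_in) auto
  have above: "lookup d j = 0" if "k < j" for j
    using that by (metis Max_ge finite_keys in_keys_iff k_def not_le)
  have "d \<in> ABB n" using ABB d(1) by blast
  then have "k \<in> {1..n}" using k by (auto simp: ABB_iff)
  moreover from this have "(\<Sum>j=n..n. lookup d j) \<le> n - n"
    using \<open>d \<in> ABB n\<close> unfolding ABB_iff by (elim conjE ballE[of _ _ n]) auto
  ultimately have "1 \<le> k" "k < n"
    using k by (auto simp: in_keys_iff intro: le_neq_implies_less)
  have "reindex (gap (Suc k)) d = d"
    using above by (intro reindex_eqI) (simp_all add: gap_def range_gap)
  then have "lookup r (reindex (gap k) d) = lookup r d"
    using invariant[OF \<open>1 \<le> k\<close> \<open>k < n\<close>] by (metis inj_gap lookup_pullback)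
  then have "reindex (gap k) d \<in> keys r"
    using d(1) by (simp add: in_keys_iff)
  moreover have "Suc k \<in> keys (reindex (gap k) d)"
    using k by (auto simp: keys_reindex gap_def image_iff intro!: bexI[of _ k])
  ultimately have "Suc k \<le> Max (keys (reindex (gap k) d))" "reindex (gap k) d \<in> keys r - {0}"
    by auto
  with max have "Suc k \<le> Max (keys d)" by (meson order_trans)
  then show False by (simp add: k_def)
qed

lemma QSym_plus_Int_ABB_span:
  assumes "keys r \<subseteq> ABB n" "r \<in> QSym_plus n"
  shows "r = 0"
  using assms
proof (induction n arbitrary: r rule: less_induct)
  case (less n)
  have "pullback (gap (Suc i)) r = pullback (gap i) r" if i: "1 \<le> i" "i < n" for i
  proof -
    have "keys (trim i r) \<subseteq> ABB (n - 1)"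
      using less.prems(1) ABB_trim[OF _ _ i] by (blast elim: keys_trimE)
    moreover have "trim i r \<in> QSym_plus (n - 1)"
      using less.prems(2) i by (rule QSym_plus_trim)
    ultimately have "trim i r = 0"
      using i by (intro less.IH) auto
    then show ?thesis
      using X_mult_trim[of i r] by simp
  qed
  with less.prems(1) have "keys r \<subseteq> {0}"
    by (rule keys_subset_0_if_gap_invariant)
  moreover have "0 \<notin> keys r"
    using QSym_plus_constant_term[OF less.prems(2)] by (simp add: in_keys_iff)
  ultimately have "keys r = {}" by blast
  then show "r = 0" by simp
qed

lemma reduction_eqI:
  assumes "keys r \<subseteq> ABB n" "p - r \<in> QSym_plus n"
  shows "reduction n p = r"
  unfolding reduction_def is_reduction_def span_monomials_iff
proof (rule the_equality)
  fix s assume s: "keys s \<subseteq> ABB n \<and> p - s \<in> QSym_plus n"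
  have "(p - r) - (p - s) \<in> QSym_plus n"
    using assms s QSym_plus_diff by blast
  then have "s - r = 0"
    using keys_diff[of s r] assms s by (intro QSym_plus_Int_ABB_span[of _ n]) auto
  then show "s = r" by simp
qed (use assms in auto)


subsection \<open>Flagged sums over plane binary trees\<close>

text \<open>The label of a node is the upper bound of its value.\<close>

fun flagged_sum :: "nat tree \<Rightarrow> nat \<Rightarrow> qpoly" where
  "flagged_sum Leaf m = 1"
| "flagged_sum (Node l b r) m = (\<Sum>k=m..b. X k * flagged_sum l k * flagged_sum r (Suc k))"

lemma polys_upto_flagged_sum: "1 \<le> m \<Longrightarrow> set_tree t \<subseteq> {..n} \<Longrightarrow> flagged_sum t m \<in> polys_upto n"
proof (induction t arbitrary: m)
  case (Node l b r)
  have "X k * flagged_sum l k * flagged_sum r (Suc k) \<in> polys_upto n" if "k \<in> {m..b}" for k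
    using that Node by (intro polys_upto_mult polys_upto_X) auto
  then show ?case unfolding flagged_sum.simps by (rule polys_upto_sum)
qed (simp add: polys_upto_1)

lemma homogeneous_flagged_sum: "homogeneous (size t) (flagged_sum t m)"
proof (induction t arbitrary: m)
  case (Node l b r)
  have "homogeneous (1 + size l + size r) (X k * flagged_sum l k * flagged_sum r (Suc k))" for k
    by (intro homogeneous_mult homogeneous_X Node)
  then show ?case by (simp add: homogeneous_sum)
qed (simp add: homogeneous_1)

lemma pullback_flagged_sum:
  assumes \<sigma>: "strict_mono \<sigma>" and "\<And>v j. v \<in> set_tree t \<Longrightarrow> \<sigma> j \<le> f v \<longleftrightarrow> j \<le> g v"
    and "\<And>j. m \<le> \<sigma> j \<longleftrightarrow> m' \<le> j"
  shows "pullback \<sigma> (flagged_sum (map_tree f t) m) = flagged_sum (map_tree g t) m'"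
  using assms(2,3)
proof (induction t arbitrary: m m')
  case Leaf
  then show ?case using \<sigma> by (simp add: pullback_1 strict_mono_imp_inj_on)
next
  case (Node l v r)
  have inj: "inj \<sigma>" using \<sigma> by (rule strict_mono_imp_inj_on)
  define h where "h k = pullback \<sigma> (X k) * pullback \<sigma> (flagged_sum (map_tree f l) k) *
    pullback \<sigma> (flagged_sum (map_tree f r) (Suc k))" for k
  have "pullback \<sigma> (flagged_sum (map_tree f (Node l v r)) m) = (\<Sum>k=m..f v. h k)"
    by (simp add: h_def pullback_sum pullback_mult inj)
  also have "\<dots> = (\<Sum>k\<in>\<sigma> ` {m'..g v}. h k)"
  proof (rule sum.mono_neutral_right)
    show "\<sigma> ` {m'..g v} \<subseteq> {m..f v}"
      using Node.prems by auto
    have "k \<notin> range \<sigma>" if "k \<in> {m..f v} - \<sigma> ` {m'..g v}" for k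
      using that Node.prems by auto
    then show "\<forall>k\<in>{m..f v} - \<sigma> ` {m'..g v}. h k = 0"
      by (simp add: h_def pullback_X_notin_range inj)
  qed simp
  also have "\<dots> = (\<Sum>j=m'..g v. h (\<sigma> j))"
    using inj by (simp add: sum.reindex inj_on_subset)
  also have "\<dots> = (\<Sum>j=m'..g v. X j * flagged_sum (map_tree g l) j * flagged_sum (map_tree g r) (Suc j))"
  proof (rule sum.cong)
    fix j
    have "\<sigma> j \<le> \<sigma> i \<longleftrightarrow> j \<le> i" "Suc (\<sigma> j) \<le> \<sigma> i \<longleftrightarrow> Suc j \<le> i" for i
      using \<sigma> by (simp_all add: strict_mono_less_eq strict_mono_less Suc_le_eq)
    then show "h (\<sigma> j) = X j * flagged_sum (map_tree g l) j * flagged_sum (map_tree g r) (Suc j)"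
      using Node by (simp add: h_def pullback_X inj)
  qed simp
  finally show ?case by simp
qed

lemma map_tree_const: "set_tree t \<subseteq> {b} \<Longrightarrow> map_tree (\<lambda>_. b) t = t"
  by (induction t) auto

lemma lookup_flagged_sum_strict_mono:
  fixes k :: nat and i a :: "nat \<Rightarrow> nat"
  assumes flags: "set_tree t \<subseteq> {n}" and mono_i: "strict_mono_on {..<k} i" "i ` {..<k} \<subseteq> {1..n}"
  shows "lookup (flagged_sum t 1) (\<Sum>r<k. single (i r) (a r)) =
    lookup (flagged_sum (map_tree (\<lambda>_. k) t) 1) (\<Sum>r<k. single (Suc r) (a r))"
proof -
  define \<sigma> where "\<sigma> j = (if j = 0 then 0 else if j \<le> k then i (j - 1) else n + j)" for j
  have range_i: "1 \<le> i r" "i r \<le> n" if "r < k" for r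
    using mono_i(2) that by auto
  have \<sigma>: "strict_mono \<sigma>"
    unfolding strict_mono_Suc_iff
  proof
    fix j
    show "\<sigma> j < \<sigma> (Suc j)"
      using range_i[of j] range_i[of "j - 1"] strict_mono_onD[OF mono_i(1), of "j - 1" j]
      by (cases "j = 0") (force simp: \<sigma>_def)+
  qed
  have "\<sigma> j \<le> n \<longleftrightarrow> j \<le> k" "1 \<le> \<sigma> j \<longleftrightarrow> 1 \<le> j" for j
    using range_i[of "j - 1"] by (auto simp: \<sigma>_def)
  then have "pullback \<sigma> (flagged_sum (map_tree (\<lambda>_. n) t) 1) = flagged_sum (map_tree (\<lambda>_. k) t) 1"
    using \<sigma> by (intro pullback_flagged_sum) auto
  then have pullback: "pullback \<sigma> (flagged_sum t 1) = flagged_sum (map_tree (\<lambda>_. k) t) 1"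
    by (simp only: map_tree_const[OF flags])
  have inj: "inj \<sigma>"
    using \<sigma> by (rule strict_mono_imp_inj_on)
  have "(\<Sum>r<k. single (i r) (a r)) = reindex \<sigma> (\<Sum>r<k. single (Suc r) (a r))"
    by (simp add: reindex_sum inj \<sigma>_def)
  then show ?thesis
    by (simp only: pullback flip: lookup_pullback[OF inj])
qed

lemma quasisymmetric_flagged_sum:
  assumes "set_tree t \<subseteq> {n}"
  shows "quasisymmetric n (flagged_sum t 1)"
proof -
  have "flagged_sum t 1 \<in> polys_upto n"
    using assms by (intro polys_upto_flagged_sum) auto
  then show ?thesis
    unfolding quasisymmetric_def using lookup_flagged_sum_strict_mono[OF assms] by simp
qed

lemma free_flagged_sum_in_QSym_plus:
  "t \<noteq> Leaf \<Longrightarrow> set_tree t \<subseteq> {n} \<Longrightarrow> flagged_sum t 1 \<in> QSym_plus n"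
  by (rule QSym_plus_generator[OF quasisymmetric_flagged_sum homogeneous_flagged_sum])
    (cases t; simp)+


subsection \<open>Flagged sums in a context\<close>

text \<open>
  A context is the path from a subtree up to the root, innermost frame first. \<open>Left_of b r\<close> makes the
  subtree the left child of a node with flag \<open>b\<close> and right subtree \<open>r\<close>.
\<close>

datatype frame = Left_of nat "nat tree" | Right_of "nat tree" nat

fun plug :: "frame list \<Rightarrow> nat tree \<Rightarrow> nat tree" where
  "plug [] t = t"
| "plug (Left_of b r # C) t = plug C (Node t b r)"
| "plug (Right_of l b # C) t = plug C (Node l b t)"

lemma flagged_sum_plug_cong:
  assumes "\<And>m. flagged_sum t m = flagged_sum u m"
  shows "flagged_sum (plug C t) m = flagged_sum (plug C u) m"
  using assms by (induction C t arbitrary: u m rule: plug.induct) simp_all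

lemma flagged_sum_plug_add_mult:
  assumes "\<And>m. flagged_sum t m = flagged_sum u m + g * flagged_sum w m"
  shows "flagged_sum (plug C t) m = flagged_sum (plug C u) m + g * flagged_sum (plug C w) m"
  using assms
proof (induction C t arbitrary: u w m rule: plug.induct[case_names hole left right])
  case (left b r C t)
  have "flagged_sum (Node t b r) m = flagged_sum (Node u b r) m + g * flagged_sum (Node w b r) m" for m
    using left.prems by (simp add: sum_distrib_left algebra_simps flip: sum.distrib)
  from left.IH[OF this] show ?case by simp
next
  case (right l b C t)
  have "flagged_sum (Node l b t) m = flagged_sum (Node l b u) m + g * flagged_sum (Node l b w) m" for m
    using right.prems by (simp add: sum_distrib_left algebra_simps flip: sum.distrib)
  from right.IH[OF this] show ?case by simp
qed simp

lemma flagged_sum_implied_flag: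
  assumes "b \<le> b'" and "\<And>k. b < k \<Longrightarrow> k \<le> b' \<Longrightarrow> flagged_sum l k = 0 \<or> flagged_sum r (Suc k) = 0"
  shows "flagged_sum (Node l b r) m = flagged_sum (Node l b' r) m"
proof -
  have "X k * flagged_sum l k * flagged_sum r (Suc k) = 0" if "k \<in> {m..b'} - {m..b}" for k
    using assms(2)[of k] that by auto
  then show ?thesis
    unfolding flagged_sum.simps using assms(1) by (intro sum.mono_neutral_left) auto
qed

lemma flagged_sum_Suc_flag:
  "flagged_sum (Node l (Suc b) Leaf) m = flagged_sum (Node l b Leaf) m
     + (if m \<le> Suc b then X (Suc b) * flagged_sum l (Suc b) else 0)"
  by simp

lemma sum_add_if_le:
  fixes f f' h :: "nat \<Rightarrow> 'a::semiring_0"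
  assumes "\<And>k. f k = f' k + (if k \<le> d then g * h k else 0)"
  shows "(\<Sum>k=m..c. f k) = (\<Sum>k=m..c. f' k) + g * (\<Sum>k=m..min c d. h k)"
proof -
  have "(\<Sum>k=m..c. if k \<le> d then g * h k else 0) = (\<Sum>k=m..min c d. g * h k)"
    by (rule sum.mono_neutral_cong_right) auto
  then show ?thesis
    by (simp add: assms sum.distrib sum_distrib_left)
qed

text \<open>
  Fixing the value of a node without right child at its flag cuts off the node and its left
  subtree; what remains is a flagged sum in which the parent inherits an upper bound.
\<close>

lemma flagged_sum_raise_left_child:
  "flagged_sum (Node (Node l (Suc b) Leaf) c r) m = flagged_sum (Node (Node l b Leaf) c r) m
     + X (Suc b) * flagged_sum l (Suc b) * flagged_sum (Node Leaf (min c (Suc b)) r) m"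
  unfolding flagged_sum.simps(2)[of _ c] flagged_sum.simps(2)[of _ "min c (Suc b)"]
  by (rule sum_add_if_le)
    (simp add: flagged_sum_Suc_flag algebra_simps del: flagged_sum.simps(2))

lemma flagged_sum_raise_right_child:
  "flagged_sum (Node l' c (Node l (Suc b) Leaf)) m = flagged_sum (Node l' c (Node l b Leaf)) m
     + X (Suc b) * flagged_sum l (Suc b) * flagged_sum (Node l' (min c b) Leaf) m"
  unfolding flagged_sum.simps(2)[of _ c] flagged_sum.simps(2)[of _ "min c b"]
  by (rule sum_add_if_le)
    (simp add: flagged_sum_Suc_flag algebra_simps del: flagged_sum.simps(2))


subsection \<open>Lifting the flags of a tree reaching beyond \<open>n\<close>\<close>

text \<open>
  With the nodes labelled \<open>s, s + 1, \<dots>\<close> in inorder, every flag is the label of the leftmost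
  descendant, capped at \<open>n\<close>.
\<close>

fun canonical_flags :: "nat \<Rightarrow> nat \<Rightarrow> nat tree \<Rightarrow> bool" where
  "canonical_flags n s Leaf \<longleftrightarrow> True"
| "canonical_flags n s (Node l b r) \<longleftrightarrow>
     b = min s n \<and> canonical_flags n s l \<and> canonical_flags n (s + size l + 1) r"

lemma canonical_flagged_sum_eq_0:
  "t \<noteq> Leaf \<Longrightarrow> canonical_flags n s t \<Longrightarrow> min s n < m \<Longrightarrow> flagged_sum t m = 0"
  by (cases t) auto

text \<open>
  A context around a subtree whose last label is \<open>i\<close>: on the path and to its left all flags are
  lifted to \<open>n\<close>, to the right they are still canonical, and the last label of the whole tree
  is at least \<open>n\<close>.
\<close>

fun lifted_context :: "nat \<Rightarrow> nat \<Rightarrow> frame list \<Rightarrow> bool" where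
  "lifted_context n i [] \<longleftrightarrow> n \<le> i"
| "lifted_context n i (Left_of b r # C) \<longleftrightarrow>
     b = n \<and> canonical_flags n (i + 2) r \<and> lifted_context n (i + 1 + size r) C"
| "lifted_context n i (Right_of l b # C) \<longleftrightarrow> b = n \<and> set_tree l \<subseteq> {n} \<and> lifted_context n i C"

fun nodes_after :: "frame list \<Rightarrow> nat" where
  "nodes_after [] = 0"
| "nodes_after (Left_of b r # C) = 1 + size r + nodes_after C"
| "nodes_after (Right_of l b # C) = nodes_after C"

text \<open>
  The flag \<open>b\<close> of the current node \<open>Node l b r\<close> is being lifted; the later nodes have the labels
  \<open>i + 1, i + 2, \<dots>\<close>. The label of the current node itself may be less than \<open>i\<close>, since its right
  child may have been cut off before.
\<close>

definition lifting_state :: "nat \<Rightarrow> nat \<Rightarrow> nat tree \<Rightarrow> nat \<Rightarrow> nat tree \<Rightarrow> frame list \<Rightarrow> bool" where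
  "lifting_state n i l b r C \<longleftrightarrow>
     set_tree l \<subseteq> {n} \<and> min i n \<le> b \<and> b \<le> n \<and> canonical_flags n (i + 1) r \<and>
     lifted_context n (i + size r) C"

definition lifting_in_ideal_below :: "nat \<Rightarrow> nat \<Rightarrow> bool" where
  "lifting_in_ideal_below n k \<longleftrightarrow>
     (\<forall>i l b r C. lifting_state n i l b r C \<longrightarrow> size r + nodes_after C < k \<longrightarrow>
     flagged_sum (plug C (Node l b r)) 1 \<in> QSym_plus n)"

lemma lifting_in_ideal_belowD:
  "lifting_in_ideal_below n k \<Longrightarrow> lifting_state n i l b r C \<Longrightarrow> size r + nodes_after C < k \<Longrightarrow>
     flagged_sum (plug C (Node l b r)) 1 \<in> QSym_plus n"
  by (simp add: lifting_in_ideal_below_def)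

lemma lifting_in_ideal_below_mono: "lifting_in_ideal_below n k \<Longrightarrow> j \<le> k \<Longrightarrow> lifting_in_ideal_below n j"
  by (simp add: lifting_in_ideal_below_def)

lemma plug_canonical_in_QSym_plus:
  assumes "t \<noteq> Leaf" "canonical_flags n (i + 1) t" "lifted_context n (i + size t) C"
    and "lifting_in_ideal_below n (size t + nodes_after C)"
  shows "flagged_sum (plug C t) 1 \<in> QSym_plus n"
  using assms
proof (induction t arbitrary: C)
  case (Node l b r)
  show ?case
  proof (cases "l = Leaf")
    case True
    then have "lifting_state n (i + 1) l b r C"
      using Node.prems(2,3) by (simp add: lifting_state_def add.commute)
    with Node.prems(4) show ?thesis
      by (rule lifting_in_ideal_belowD) simp
  next
    case False
    then have "flagged_sum (Node l b r) m = flagged_sum (Node l n r) m" for m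
      using Node.prems(2) canonical_flagged_sum_eq_0 by (intro flagged_sum_implied_flag) auto
    then have "flagged_sum (plug C (Node l b r)) 1 = flagged_sum (plug (Left_of n r # C) l) 1"
      by (simp add: flagged_sum_plug_cong)
    moreover have "flagged_sum (plug (Left_of n r # C) l) 1 \<in> QSym_plus n"
      using False Node.prems by (intro Node.IH(1)) (auto simp: ac_simps)
    ultimately show ?thesis by simp
  qed
qed simp

lemma plug_free_in_QSym_plus:
  assumes "t \<noteq> Leaf" "set_tree t \<subseteq> {n}" "lifted_context n i C"
    and "lifting_in_ideal_below n (nodes_after C)"
  shows "flagged_sum (plug C t) 1 \<in> QSym_plus n"
  using assms
proof (induction C t rule: plug.induct[case_names hole left right])
  case (hole t)
  then show ?case using free_flagged_sum_in_QSym_plus[of t n] by simp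
next
  case (left b r C t)
  then have "lifting_state n (i + 1) t b r C"
    by (simp add: lifting_state_def)
  with left.prems(4) show ?case
    unfolding plug.simps by (rule lifting_in_ideal_belowD) simp
qed simp

lemma lifting_state_in_QSym_plus_if_right_child:
  assumes "lifting_state n i l b r C" "r \<noteq> Leaf" "lifting_in_ideal_below n (size r + nodes_after C)"
  shows "flagged_sum (plug C (Node l b r)) 1 \<in> QSym_plus n"
proof -
  note state = assms(1)[unfolded lifting_state_def]
  have "flagged_sum (Node l b r) m = flagged_sum (Node l n r) m" for m
    using assms(2) state canonical_flagged_sum_eq_0 by (intro flagged_sum_implied_flag) auto
  then have "flagged_sum (plug C (Node l b r)) 1 = flagged_sum (plug (Right_of l n # C) r) 1"
    by (simp add: flagged_sum_plug_cong)
  also have "\<dots> \<in> QSym_plus n"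
    using assms(2,3) state by (intro plug_canonical_in_QSym_plus[of r n i]) auto
  finally show ?thesis .
qed

lemma plug_raise_flag:
  assumes state: "lifting_state n i l b Leaf C" and "b < n"
    and below: "lifting_in_ideal_below n (nodes_after C)"
    and parent_of_right_child: "\<And>l' c C' i l b. C = Right_of l' c # C' \<Longrightarrow>
      lifting_state n i l b Leaf C' \<Longrightarrow> flagged_sum (plug C' (Node l b Leaf)) 1 \<in> QSym_plus n"
  shows "\<exists>q\<in>QSym_plus n. flagged_sum (plug C (Node l (Suc b) Leaf)) 1 =
    flagged_sum (plug C (Node l b Leaf)) 1 + X (Suc b) * flagged_sum l (Suc b) * q"
proof -
  consider (hole) "C = []" | (left) c r C' where "C = Left_of c r # C'"
    | (right) l' c C' where "C = Right_of l' c # C'"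
    by (metis frame.exhaust neq_Nil_conv)
  then show ?thesis
  proof cases
    case hole
    then have "n \<le> b" using state by (auto simp: lifting_state_def)
    with \<open>b < n\<close> show ?thesis by simp
  next
    case left
    then have "lifting_state n (i + 1) Leaf (min c (Suc b)) r C'"
      using state \<open>b < n\<close> by (auto simp: lifting_state_def)
    with below have "flagged_sum (plug C' (Node Leaf (min c (Suc b)) r)) 1 \<in> QSym_plus n"
      by (rule lifting_in_ideal_belowD) (simp add: left)
    then show ?thesis
      unfolding left plug.simps
      using flagged_sum_plug_add_mult[OF flagged_sum_raise_left_child] by blast
  next
    case right
    then have "lifting_state n i l' (min c b) Leaf C'"
      using state \<open>b < n\<close> by (auto simp: lifting_state_def)
    with right have "flagged_sum (plug C' (Node l' (min c b) Leaf)) 1 \<in> QSym_plus n"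
      by (rule parent_of_right_child)
    then show ?thesis
      unfolding right plug.simps
      using flagged_sum_plug_add_mult[OF flagged_sum_raise_right_child] by blast
  qed
qed

lemma lifting_state_in_QSym_plus_if_no_right_child:
  assumes "lifting_state n i l b Leaf C" "lifting_in_ideal_below n (nodes_after C)"
  shows "flagged_sum (plug C (Node l b Leaf)) 1 \<in> QSym_plus n"
  using assms
proof (induction "length C" arbitrary: i l b C rule: less_induct)
  case less
  note state = less.prems(1)[unfolded lifting_state_def]
  have parent_of_right_child: "flagged_sum (plug C' (Node l' c Leaf)) 1 \<in> QSym_plus n"
    if "C = Right_of l'' c' # C'" "lifting_state n j l' c Leaf C'" for l'' c' C' j l' c
    using that less.prems(2) by (intro less.hyps) auto
  have "b \<le> n" using state by simp
  then show ?case
  proof (induction rule: inc_induct)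
    case base
    show ?case
      using state less.prems(2) by (intro plug_free_in_QSym_plus[of _ n i]) auto
  next
    case (step b')
    then have "lifting_state n i l b' Leaf C"
      using state by (simp add: lifting_state_def)
    then have "\<exists>q\<in>QSym_plus n. flagged_sum (plug C (Node l (Suc b') Leaf)) 1 =
        flagged_sum (plug C (Node l b' Leaf)) 1 + X (Suc b') * flagged_sum l (Suc b') * q"
      using step(2) less.prems(2) by (rule plug_raise_flag) (rule parent_of_right_child)
    then obtain q where q: "q \<in> QSym_plus n" "flagged_sum (plug C (Node l (Suc b') Leaf)) 1 =
        flagged_sum (plug C (Node l b' Leaf)) 1 + X (Suc b') * flagged_sum l (Suc b') * q"
      by blast
    have "X (Suc b') * flagged_sum l (Suc b') \<in> polys_upto n"
      using step(2) state by (intro polys_upto_mult polys_upto_X polys_upto_flagged_sum) auto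
    then have "X (Suc b') * flagged_sum l (Suc b') * q \<in> QSym_plus n"
      using q(1) by (rule QSym_plus_mult)
    with step.IH show ?case
      unfolding q(2) using QSym_plus_diff by fastforce
  qed
qed

lemma lifting_in_ideal_below: "lifting_in_ideal_below n k"
proof (induction k)
  case (Suc k)
  show ?case
    unfolding lifting_in_ideal_below_def
  proof (intro allI impI)
    fix i l b r C
    assume state: "lifting_state n i l b r C" and "size r + nodes_after C < Suc k"
    then have below: "lifting_in_ideal_below n (size r + nodes_after C)"
      using Suc.IH by (simp add: lifting_in_ideal_below_mono)
    show "flagged_sum (plug C (Node l b r)) 1 \<in> QSym_plus n"
    proof (cases "r = Leaf")
      case True
      with state below show ?thesis
        using lifting_state_in_QSym_plus_if_no_right_child[of n i l b C] by simp
    next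
      case False
      with state below show ?thesis
        by (intro lifting_state_in_QSym_plus_if_right_child)
    qed
  qed
qed (simp add: lifting_in_ideal_below_def)

lemma canonical_flagged_sum_in_QSym_plus:
  assumes "t \<noteq> Leaf" "canonical_flags n s t" "1 \<le> s" "n < s + size t"
  shows "flagged_sum t 1 \<in> QSym_plus n"
  using plug_canonical_in_QSym_plus[of t n "s - 1" "[]"] assms lifting_in_ideal_below by simp


subsection \<open>Sums over labelings\<close>

definition labeling_sum :: "'a set \<Rightarrow> (('a \<Rightarrow> nat) \<Rightarrow> bool) \<Rightarrow> qpoly" where
  "labeling_sum A P = (\<Sum>\<kappa> | \<kappa> \<in> extensional A \<and> P \<kappa>. \<Prod>v\<in>A. X (\<kappa> v))"

lemma labeling_sum_empty: "labeling_sum {} (\<lambda>\<kappa>. True) = 1"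
  by (simp add: labeling_sum_def extensional_empty)

lemma labeling_sum_singleton: "labeling_sum {a} (\<lambda>\<kappa>. \<kappa> a = k) = X k"
proof -
  have "{\<kappa>. \<kappa> \<in> extensional {a} \<and> \<kappa> a = k} = {(\<lambda>v\<in>{a}. k)}"
    by (auto simp: extensional_def fun_eq_iff)
  then show ?thesis by (simp add: labeling_sum_def)
qed

lemma labeling_sum_Un:
  assumes fin: "finite A" "finite B" and disj: "A \<inter> B = {}"
    and local_P: "\<And>\<kappa>. P (restrict \<kappa> A) = P \<kappa>" and local_Q: "\<And>\<kappa>. Q (restrict \<kappa> B) = Q \<kappa>"
  shows "labeling_sum (A \<union> B) (\<lambda>\<kappa>. P \<kappa> \<and> Q \<kappa>) = labeling_sum A P * labeling_sum B Q"
proof -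
  let ?KA = "{\<kappa>. \<kappa> \<in> extensional A \<and> P \<kappa>}" and ?KB = "{\<kappa>. \<kappa> \<in> extensional B \<and> Q \<kappa>}"
  let ?K = "{\<kappa>. \<kappa> \<in> extensional (A \<union> B) \<and> P \<kappa> \<and> Q \<kappa>}"
  let ?split = "\<lambda>\<kappa>. (restrict \<kappa> A, restrict \<kappa> B)" and ?glue = "\<lambda>(\<kappa>, \<mu>). override_on \<mu> \<kappa> A"
  have glue: "restrict (override_on \<mu> \<kappa> A) A = \<kappa>" "restrict (override_on \<mu> \<kappa> A) B = \<mu>"
    if "\<kappa> \<in> extensional A" "\<mu> \<in> extensional B" for \<kappa> \<mu> :: "'a \<Rightarrow> nat"
    using that disj by (auto simp: fun_eq_iff override_on_def extensional_def)
  have "labeling_sum (A \<union> B) (\<lambda>\<kappa>. P \<kappa> \<and> Q \<kappa>) =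
      (\<Sum>(\<kappa>, \<mu>)\<in>?KA \<times> ?KB. (\<Prod>v\<in>A. X (\<kappa> v)) * (\<Prod>v\<in>B. X (\<mu> v)))"
    unfolding labeling_sum_def
  proof (rule sum.reindex_bij_witness[of _ ?glue ?split])
    fix \<kappa> assume \<kappa>: "\<kappa> \<in> ?K"
    then show "?glue (?split \<kappa>) = \<kappa>"
      by (auto simp: fun_eq_iff override_on_def extensional_def)
    show "?split \<kappa> \<in> ?KA \<times> ?KB"
      using \<kappa> local_P local_Q by simp
    show "(case ?split \<kappa> of (\<kappa>, \<mu>) \<Rightarrow> (\<Prod>v\<in>A. X (\<kappa> v)) * (\<Prod>v\<in>B. X (\<mu> v))) = (\<Prod>v\<in>A \<union> B. X (\<kappa> v))"
      using fin disj by (simp add: prod.union_disjoint)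
  next
    fix p assume "p \<in> ?KA \<times> ?KB"
    then obtain \<kappa> \<mu> where p: "p = (\<kappa>, \<mu>)" "\<kappa> \<in> extensional A" "P \<kappa>" "\<mu> \<in> extensional B" "Q \<mu>"
      by auto
    then show "?split (?glue p) = p"
      by (simp add: glue)
    show "?glue p \<in> ?K"
      using p local_P[of "override_on \<mu> \<kappa> A"] local_Q[of "override_on \<mu> \<kappa> A"]
      by (simp add: glue) (auto simp: extensional_def override_on_def)
  qed
  also have "\<dots> = labeling_sum A P * labeling_sum B Q"
    unfolding labeling_sum_def sum_product by (simp add: sum.cartesian_product)
  finally show ?thesis .
qed

lemma labeling_sum_UN:
  assumes "finite I" "\<And>i. i \<in> I \<Longrightarrow> finite (A i)"
    and "\<And>i j. i \<in> I \<Longrightarrow> j \<in> I \<Longrightarrow> i \<noteq> j \<Longrightarrow> A i \<inter> A j = {}"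
    and local_P: "\<And>i B \<kappa>. A i \<subseteq> B \<Longrightarrow> P i (restrict \<kappa> B) = P i \<kappa>"
  shows "labeling_sum (\<Union>i\<in>I. A i) (\<lambda>\<kappa>. \<forall>i\<in>I. P i \<kappa>) = (\<Prod>i\<in>I. labeling_sum (A i) (P i))"
  using assms(1-3)
proof (induction I)
  case (insert i I)
  have "labeling_sum (\<Union>i\<in>insert i I. A i) (\<lambda>\<kappa>. \<forall>i\<in>insert i I. P i \<kappa>) =
      labeling_sum (A i \<union> (\<Union>i\<in>I. A i)) (\<lambda>\<kappa>. P i \<kappa> \<and> (\<forall>i\<in>I. P i \<kappa>))"
    by simp
  also have "\<dots> = labeling_sum (A i) (P i) * labeling_sum (\<Union>i\<in>I. A i) (\<lambda>\<kappa>. \<forall>i\<in>I. P i \<kappa>)"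
  proof (rule labeling_sum_Un)
    show "A i \<inter> (\<Union>i\<in>I. A i) = {}"
      using insert by blast
    show "(\<forall>i\<in>I. P i (restrict \<kappa> (\<Union>i\<in>I. A i))) = (\<forall>i\<in>I. P i \<kappa>)" for \<kappa>
      using local_P by (intro ball_cong refl) blast
  qed (use insert local_P in auto)
  finally show ?case
    using insert by simp
qed (simp add: labeling_sum_empty)

lemma labeling_sum_group:
  assumes "finite {\<kappa>. \<kappa> \<in> extensional A \<and> P \<kappa>}" "finite K" "\<And>\<kappa>. P \<kappa> \<Longrightarrow> \<kappa> a \<in> K"
  shows "labeling_sum A P = (\<Sum>k\<in>K. labeling_sum A (\<lambda>\<kappa>. \<kappa> a = k \<and> P \<kappa>))"
proof -
  have "labeling_sum A P =
      (\<Sum>k\<in>K. \<Sum>\<kappa> | \<kappa> \<in> {\<kappa>. \<kappa> \<in> extensional A \<and> P \<kappa>} \<and> \<kappa> a = k. \<Prod>v\<in>A. X (\<kappa> v))"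
    unfolding labeling_sum_def using assms by (intro sum.group[symmetric]) auto
  then show ?thesis
    by (simp add: labeling_sum_def conj_ac)
qed


subsection \<open>Labelings of trees and forests\<close>

fun labels_tree :: "('a \<Rightarrow> nat) \<Rightarrow> 'a tree \<Rightarrow> nat \<Rightarrow> ('a \<Rightarrow> nat) \<Rightarrow> bool" where
  "labels_tree b Leaf m \<kappa> \<longleftrightarrow> True"
| "labels_tree b (Node l v r) m \<kappa> \<longleftrightarrow> m \<le> \<kappa> v \<and> \<kappa> v \<le> b v \<and>
     labels_tree b l (\<kappa> v) \<kappa> \<and> labels_tree b r (Suc (\<kappa> v)) \<kappa>"

lemma labels_tree_restrict:
  "set_tree t \<subseteq> A \<Longrightarrow> labels_tree b t m (restrict \<kappa> A) = labels_tree b t m \<kappa>"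
  by (induction t arbitrary: m) auto

lemma labels_tree_ge: "labels_tree b t m \<kappa> \<Longrightarrow> v \<in> set_tree t \<Longrightarrow> m \<le> \<kappa> v"
proof (induction t arbitrary: m)
  case (Node l u r)
  then show ?case using Node.IH(1)[of "\<kappa> u"] Node.IH(2)[of "Suc (\<kappa> u)"] by fastforce
qed simp

lemma labels_tree_iff:
  "labels_tree b t m \<kappa> \<longleftrightarrow> (t \<noteq> Leaf \<longrightarrow> m \<le> \<kappa> (value t)) \<and> (\<forall>v\<in>set_tree t. \<kappa> v \<le> b v) \<and>
    (\<forall>l u r. Node l u r \<in> subtrees t \<longrightarrow>
      (l \<noteq> Leaf \<longrightarrow> \<kappa> u \<le> \<kappa> (value l)) \<and> (r \<noteq> Leaf \<longrightarrow> \<kappa> u < \<kappa> (value r)))"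
  by (induction t arbitrary: m) (auto simp: Suc_le_eq)

lemma finite_labels_tree: "finite {\<kappa>. \<kappa> \<in> extensional (set_tree t) \<and> labels_tree b t m \<kappa>}"
proof (rule finite_subset)
  show "{\<kappa>. \<kappa> \<in> extensional (set_tree t) \<and> labels_tree b t m \<kappa>} \<subseteq> (\<Pi>\<^sub>E v\<in>set_tree t. {..b v})"
    by (clarsimp simp: labels_tree_iff PiE_iff)
qed (intro finite_PiE; simp)

lemma flagged_sum_eq_labeling_sum:
  "distinct (inorder t) \<Longrightarrow>
     flagged_sum (map_tree b t) m = labeling_sum (set_tree t) (labels_tree b t m)"
proof (induction t arbitrary: m)
  case Leaf
  then show ?case by (simp add: labeling_sum_empty)
next
  case (Node l a r)
  let ?t = "Node l a r" and ?l = "set_tree l" and ?r = "set_tree r"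
  have disj: "{a} \<inter> (?l \<union> ?r) = {}" "?l \<inter> ?r = {}"
    using Node.prems by auto
  have fixed_root: "labeling_sum (set_tree ?t) (\<lambda>\<kappa>. \<kappa> a = k \<and> labels_tree b ?t m \<kappa>) =
      X k * (labeling_sum ?l (labels_tree b l k) * labeling_sum ?r (labels_tree b r (Suc k)))"
    if "k \<in> {m..b a}" for k
  proof -
    have "labeling_sum (set_tree ?t) (\<lambda>\<kappa>. \<kappa> a = k \<and> labels_tree b ?t m \<kappa>) =
        labeling_sum ({a} \<union> (?l \<union> ?r))
          (\<lambda>\<kappa>. \<kappa> a = k \<and> labels_tree b l k \<kappa> \<and> labels_tree b r (Suc k) \<kappa>)"
      using that by (auto simp: labeling_sum_def intro!: sum.cong)
    also have "\<dots> = labeling_sum {a} (\<lambda>\<kappa>. \<kappa> a = k) *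
        labeling_sum (?l \<union> ?r) (\<lambda>\<kappa>. labels_tree b l k \<kappa> \<and> labels_tree b r (Suc k) \<kappa>)"
      using disj(1) by (intro labeling_sum_Un) (simp_all add: labels_tree_restrict)
    finally show ?thesis
      using disj(2) by (simp add: labeling_sum_singleton labeling_sum_Un labels_tree_restrict)
  qed
  have "labeling_sum (set_tree ?t) (labels_tree b ?t m) =
      (\<Sum>k=m..b a. labeling_sum (set_tree ?t) (\<lambda>\<kappa>. \<kappa> a = k \<and> labels_tree b ?t m \<kappa>))"
    by (intro labeling_sum_group finite_labels_tree) auto
  also have "\<dots> = (\<Sum>k=m..b a. X k *
      (labeling_sum ?l (labels_tree b l k) * labeling_sum ?r (labels_tree b r (Suc k))))"
    using fixed_root by (intro sum.cong) auto
  also have "\<dots> = flagged_sum (map_tree b ?t) m"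
    using Node by (simp add: mult.assoc)
  finally show ?case ..
qed

lemma left_child_iff:
  "left_child F u v \<longleftrightarrow> (\<exists>T\<in>F. \<exists>l r. Node l u r \<in> subtrees T \<and> l \<noteq> Leaf \<and> v = value l)"
  unfolding left_child_def by (metis tree.collapse tree.distinct(1) tree.sel(2))

lemma right_child_iff:
  "right_child F u v \<longleftrightarrow> (\<exists>T\<in>F. \<exists>l r. Node l u r \<in> subtrees T \<and> r \<noteq> Leaf \<and> v = value r)"
  unfolding right_child_def by (metis tree.collapse tree.distinct(1) tree.sel(2))

lemma forest_labelings_eq:
  "forest_labelings F = {\<kappa>. \<kappa> \<in> extensional (IN F) \<and> (\<forall>T\<in>F. labels_tree (rho F) T 1 \<kappa>)}"
  (is "?L = ?R")
proof (intro equalityI subsetI)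
  fix \<kappa> assume \<kappa>: "\<kappa> \<in> ?L"
  have "labels_tree (rho F) T 1 \<kappa>" if "T \<in> F" for T
  proof -
    have "1 \<le> \<kappa> v \<and> \<kappa> v \<le> rho F v" if "v \<in> set_tree T" for v
      using \<kappa> that \<open>T \<in> F\<close> by (auto simp: forest_labelings_def IN_def PiE_iff)
    moreover have "value T \<in> set_tree T" if "T \<noteq> Leaf"
      using that by (cases T) auto
    moreover have "(l \<noteq> Leaf \<longrightarrow> \<kappa> u \<le> \<kappa> (value l)) \<and> (r \<noteq> Leaf \<longrightarrow> \<kappa> u < \<kappa> (value r))"
      if "Node l u r \<in> subtrees T" for l u r
      using \<kappa> that \<open>T \<in> F\<close> unfolding forest_labelings_def left_child_iff right_child_iff by blast
    ultimately show ?thesis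
      unfolding labels_tree_iff by blast
  qed
  with \<kappa> show "\<kappa> \<in> ?R"
    by (auto simp: forest_labelings_def PiE_def)
next
  fix \<kappa> assume \<kappa>: "\<kappa> \<in> ?R"
  then have labels: "labels_tree (rho F) T 1 \<kappa>" if "T \<in> F" for T
    using that by blast
  have "1 \<le> \<kappa> v \<and> \<kappa> v \<le> rho F v" if v: "v \<in> IN F" for v
  proof -
    obtain T where "T \<in> F" "v \<in> set_tree T"
      using v by (auto simp: IN_def)
    then show ?thesis
      using labels[of T] labels_tree_ge[of "rho F" T 1 \<kappa> v] by (simp add: labels_tree_iff)
  qed
  moreover have "\<kappa> u \<le> \<kappa> v" if "left_child F u v" for u v
    using labels that by (auto simp: left_child_iff labels_tree_iff)
  moreover have "\<kappa> u < \<kappa> v" if "right_child F u v" for u v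
    using labels that by (auto simp: right_child_iff labels_tree_iff)
  ultimately show "\<kappa> \<in> ?L"
    using \<kappa> by (auto simp: forest_labelings_def PiE_def)
qed

lemma forest_poly_eq_prod:
  assumes "finite F" "\<And>T. T \<in> F \<Longrightarrow> distinct (inorder T)"
    and "\<And>T T'. T \<in> F \<Longrightarrow> T' \<in> F \<Longrightarrow> T \<noteq> T' \<Longrightarrow> set_tree T \<inter> set_tree T' = {}"
  shows "forest_poly F = (\<Prod>T\<in>F. flagged_sum (map_tree (rho F) T) 1)"
proof -
  have "forest_poly F = labeling_sum (\<Union>T\<in>F. set_tree T) (\<lambda>\<kappa>. \<forall>T\<in>F. labels_tree (rho F) T 1 \<kappa>)"
    by (simp add: forest_poly_def forest_labelings_eq labeling_sum_def IN_def)
  also have "\<dots> = (\<Prod>T\<in>F. labeling_sum (set_tree T) (labels_tree (rho F) T 1))"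
    using assms by (intro labeling_sum_UN) (simp_all add: labels_tree_restrict)
  also have "\<dots> = (\<Prod>T\<in>F. flagged_sum (map_tree (rho F) T) 1)"
    using assms(2) by (simp add: flagged_sum_eq_labeling_sum)
  finally show ?thesis .
qed


subsection \<open>Indexed forests\<close>

lemma interval_subset_block:
  assumes "I \<in> blocks S" "x \<in> I" "x \<in> {a..b}" "{a..b} \<subseteq> S"
  shows "{a..b} \<subseteq> I"
proof -
  obtain a' b' where I: "I = {a'..b'}" "a' - 1 \<notin> S" "b' + 1 \<notin> S"
    using assms(1) by (auto simp: blocks_def)
  have "a' - 1 \<in> {a..b}" if "a < a'" using that I(1) assms(2,3) by auto
  then have "a' \<le> a" using I(2) assms(4) by force
  moreover have "b' + 1 \<in> {a..b}" if "b' < b" using that I(1) assms(2,3) by auto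
  then have "b \<le> b'" using I(3) assms(4) by force
  ultimately show ?thesis using I(1) by auto
qed

lemma atLeastLessThan_in_blocks:
  assumes "a < b" "{a..<b} \<subseteq> S" "a - 1 \<notin> S" "b \<notin> S"
  shows "{a..<b} \<in> blocks S"
proof -
  have "{a..<b} = {a..b - 1}" "a \<le> b - 1" "b - 1 + 1 = b"
    using assms(1) by auto
  with assms(2-4) show ?thesis
    unfolding blocks_def by (metis (mono_tags, lifting) mem_Collect_eq)
qed

lemma blocks_disjoint:
  assumes "I \<in> blocks S" "J \<in> blocks S" "x \<in> I" "x \<in> J"
  shows "I = J"
proof -
  have "J \<subseteq> I" if I: "I \<in> blocks S" "x \<in> I" and J: "J \<in> blocks S" "x \<in> J" for I J
  proof -
    obtain a b where "J = {a..b}" "{a..b} \<subseteq> S"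
      using J(1) by (auto simp: blocks_def)
    then show ?thesis
      using interval_subset_block[OF I] J(2) by simp
  qed
  with assms show ?thesis by blast
qed

lemma indexed_forest_on_set_tree: "indexed_forest_on S F \<Longrightarrow> T \<in> F \<Longrightarrow> set_tree T \<in> blocks S"
  by (auto simp: indexed_forest_on_def bij_betw_def)

lemma indexed_forest_on_tree:
  assumes forest: "indexed_forest_on S F" and T_in: "T \<in> F"
  obtains a b where "inorder T = [a..<b]" "1 \<le> a" "a < b"
proof -
  obtain a b where ab: "a \<le> b" "set_tree T = {a..b}" "{a..b} \<subseteq> S"
    using indexed_forest_on_set_tree[OF forest T_in] by (auto simp: blocks_def)
  then have "set_tree T = {a..<Suc b}" by auto
  then have "inorder T = [a..<Suc b]"
    using forest T_in by (simp add: indexed_forest_on_def del: upt_Suc)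
  moreover have "a \<in> S" "S \<subseteq> {1..}"
    using ab forest by (auto simp: indexed_forest_on_def)
  ultimately show thesis
    using that[of a "Suc b"] ab(1) by auto
qed

lemma indexed_forest_on_bst: "indexed_forest_on S F \<Longrightarrow> T \<in> F \<Longrightarrow> bst T"
  by (auto elim: indexed_forest_on_tree simp: bst_iff_sorted_wrt_less)

lemma indexed_forest_on_distinct: "indexed_forest_on S F \<Longrightarrow> T \<in> F \<Longrightarrow> distinct (inorder T)"
  by (auto elim: indexed_forest_on_tree)

lemma indexed_forest_on_disjoint:
  assumes "indexed_forest_on S F" "T \<in> F" "T' \<in> F" "x \<in> set_tree T" "x \<in> set_tree T'"
  shows "T = T'"
  using assms blocks_disjoint[of "set_tree T" S "set_tree T'" x]
  by (auto simp: indexed_forest_on_def bij_betw_def dest: inj_onD)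

lemma IN_subset_support: "indexed_forest_on S F \<Longrightarrow> IN F \<subseteq> S"
  using indexed_forest_on_set_tree by (fastforce simp: IN_def blocks_def)

lemma finite_IN: "indexed_forest_on S F \<Longrightarrow> finite (IN F)"
  using IN_subset_support[of S F] finite_subset[of "IN F" S] by (simp add: indexed_forest_on_def)

lemma finite_indexed_forest:
  assumes "indexed_forest_on S F"
  shows "finite F"
proof -
  have "finite (blocks S)"
    using assms
    by (intro finite_subset[of "blocks S" "Pow S"]) (auto simp: indexed_forest_on_def blocks_def)
  then show ?thesis
    using assms bij_betw_finite unfolding indexed_forest_on_def by blast
qed

lemma leftmost_eq_hd: "t \<noteq> Leaf \<Longrightarrow> leftmost t = hd (inorder t)"
  by (induction t rule: leftmost.induct) (auto simp: hd_append)

lemma leftmost_Node_in: "leftmost (Node l v r) \<in> insert v (set_tree l)"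
  using hd_in_set[of "inorder l"] by (cases "l = Leaf") (auto simp: leftmost_eq_hd hd_append)

lemma bst_subtree: "t' \<in> subtrees t \<Longrightarrow> bst t \<Longrightarrow> bst t'"
  by (induction t) auto

lemma set_subtree: "t' \<in> subtrees t \<Longrightarrow> set_tree t' \<subseteq> set_tree t"
  by (induction t) auto

lemma subtree_unique:
  "distinct (inorder t) \<Longrightarrow> Node l v r \<in> subtrees t \<Longrightarrow> Node l' v r' \<in> subtrees t \<Longrightarrow> l = l' \<and> r = r'"
  by (induction t) (auto dest: in_set_tree_if)

lemma rho_eq_leftmost:
  assumes forest: "indexed_forest_on S F" and T_in: "T \<in> F" and sub: "Node l v r \<in> subtrees T"
  shows "rho F v = leftmost (Node l v r)"
  unfolding rho_def
proof (rule the_equality)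
  show "\<exists>T\<in>F. \<exists>l' r'. Node l' v r' \<in> subtrees T \<and> leftmost (Node l v r) = leftmost (Node l' v r')"
    using T_in sub by blast
next
  fix i assume "\<exists>T\<in>F. \<exists>l r. Node l v r \<in> subtrees T \<and> i = leftmost (Node l v r)"
  then obtain T' l' r' where T': "T' \<in> F" "Node l' v r' \<in> subtrees T'" "i = leftmost (Node l' v r')"
    by blast
  then have "T' = T"
    using indexed_forest_on_disjoint[OF forest, of T' T v] T_in sub by (auto dest: in_set_tree_if)
  moreover have "distinct (inorder T)"
    using forest T_in by (rule indexed_forest_on_distinct)
  ultimately show "i = leftmost (Node l v r)"
    using subtree_unique[of T l v r l' r'] T' sub by simp
qed

lemma rho_in_tree:
  assumes forest: "indexed_forest_on S F" and T_in: "T \<in> F" and v: "v \<in> set_tree T"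
  shows "rho F v \<in> set_tree T" "rho F v \<le> v"
proof -
  obtain l r where sub: "Node l v r \<in> subtrees T"
    using set_treeE[OF v] by blast
  then have rho: "rho F v \<in> insert v (set_tree l)"
    using rho_eq_leftmost[OF forest T_in] leftmost_Node_in by simp
  then show "rho F v \<in> set_tree T"
    using set_subtree[OF sub] by auto
  have "bst (Node l v r)"
    using indexed_forest_on_bst[OF forest T_in] bst_subtree[OF sub] by simp
  with rho show "rho F v \<le> v" by auto
qed

lemma inorder_uptD:
  assumes "inorder t = [a..<b]"
  shows "set_tree t = {a..<b}" "size t = b - a"
  using arg_cong[OF assms, of set] arg_cong[OF assms, of length] by simp_all

lemma upt_eq_append_Cons:
  assumes "[a..<b] = xs @ v # ys"
  shows "v = a + length xs" "ys = [Suc v..<b]" "xs = [a..<v]"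
proof -
  have len: "a + length xs < b"
    using arg_cong[OF assms, of length] by simp
  have "xs = take (length xs) [a..<b]" "v # ys = drop (length xs) [a..<b]"
    using assms by simp_all
  then have xs: "xs = [a..<a + length xs]" and "v # ys = [a + length xs..<b]"
    using len by (simp_all add: take_upt drop_upt)
  then show v: "v = a + length xs" and "ys = [Suc v..<b]"
    using upt_eq_Cons_conv[of "a + length xs" b v ys] by auto
  show "xs = [a..<v]"
    using xs by (simp only: v)
qed

lemma canonical_flags_map_tree:
  assumes "inorder t = [a..<b]"
    and "\<And>l v r. Node l v r \<in> subtrees t \<Longrightarrow> f v = leftmost (Node l v r) \<and> f v \<le> n"
  shows "canonical_flags n a (map_tree f t)"
  using assms
proof (induction t arbitrary: a b)
  case (Node l v r)
  then have "[a..<b] = inorder l @ v # inorder r" by simp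
  from upt_eq_append_Cons[OF this]
  have "v = a + size l" "inorder r = [Suc v..<b]" "inorder l = [a..<v]"
    unfolding length_inorder .
  moreover have "leftmost (Node l v r) = a"
    unfolding leftmost_eq_hd[OF tree.distinct(2)] Node.prems(1)
    using Node.prems(1) by (cases "a < b") auto
  ultimately show ?case
    using Node.IH(1)[of a v] Node.IH(2)[of "Suc v" b] Node.prems(2)[of l v r] Node.prems(2) by auto
qed simp

lemma forest_poly_in_QSym_plus:
  assumes forest: "indexed_forest_on S F" and rho: "\<And>v. v \<in> IN F \<Longrightarrow> rho F v \<le> n"
    and v: "v \<in> IN F" "n \<le> v"
  shows "forest_poly F \<in> QSym_plus n"
proof -
  obtain T where T: "T \<in> F" "v \<in> set_tree T"
    using v(1) by (auto simp: IN_def)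
  obtain a b where ab: "inorder T = [a..<b]" "1 \<le> a" "a < b"
    using indexed_forest_on_tree[OF forest T(1)] .
  have "forest_poly F = (\<Prod>T\<in>F. flagged_sum (map_tree (rho F) T) 1)"
    using indexed_forest_on_distinct[OF forest] indexed_forest_on_disjoint[OF forest]
      finite_indexed_forest[OF forest]
    by (intro forest_poly_eq_prod) auto
  also have "\<dots> =
      (\<Prod>T\<in>F - {T}. flagged_sum (map_tree (rho F) T) 1) * flagged_sum (map_tree (rho F) T) 1"
    using finite_indexed_forest[OF forest] T(1) by (simp add: prod.remove mult.commute)
  also have "\<dots> \<in> QSym_plus n"
  proof (rule QSym_plus_mult)
    show "(\<Prod>T\<in>F - {T}. flagged_sum (map_tree (rho F) T) 1) \<in> polys_upto n"
      using rho by (intro polys_upto_prod polys_upto_flagged_sum) (auto simp: tree.set_map IN_def)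
    have "canonical_flags n a (map_tree (rho F) T)"
    proof (rule canonical_flags_map_tree[OF ab(1)])
      fix l w r assume sub: "Node l w r \<in> subtrees T"
      then have "w \<in> IN F"
        using T(1) by (auto simp: IN_def dest: in_set_tree_if)
      then show "rho F w = leftmost (Node l w r) \<and> rho F w \<le> n"
        using rho[of w] rho_eq_leftmost[OF forest T(1) sub] by simp
    qed
    moreover have "T \<noteq> Leaf" using T(2) by auto
    moreover have "n < a + size T"
      using T(2) v(2) ab(3) inorder_uptD[OF ab(1)] by simp
    ultimately show "flagged_sum (map_tree (rho F) T) 1 \<in> QSym_plus n"
      using ab(2) by (intro canonical_flagged_sum_in_QSym_plus[of _ n a]) auto
  qed
  finally show ?thesis .
qed


subsection \<open>Codes and exponents\<close>

lemma sum_card_fibres: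
  assumes "finite V" "finite A"
  shows "(\<Sum>i\<in>A. card {v \<in> V. f v = i}) = card {v \<in> V. f v \<in> A}"
proof -
  have "(\<Sum>i\<in>A. card {v \<in> V. f v = i}) = card (\<Union>i\<in>A. {v \<in> V. f v = i})"
    using assms by (intro card_UN_disjoint[symmetric]) auto
  also have "(\<Union>i\<in>A. {v \<in> V. f v = i}) = {v \<in> V. f v \<in> A}" by auto
  finally show ?thesis .
qed

lemma sum_forest_code:
  "indexed_forest_on S F \<Longrightarrow> finite A \<Longrightarrow>
     (\<Sum>i\<in>A. forest_code F i) = card {v \<in> IN F. rho F v \<in> A}"
  unfolding forest_code_def using finite_IN by (rule sum_card_fibres)

lemma prod_X_eq_monomial: "(\<Prod>v\<in>A. X (\<kappa> v)) = monomial (\<Sum>v\<in>A. single (\<kappa> v) 1)"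
  by (induction A rule: infinite_finite_induct) (simp_all add: X_def monomial_def mult_single)

lemma keys_forest_polyE:
  assumes forest: "indexed_forest_on S F" and "d \<in> keys (forest_poly F)"
  obtains \<kappa> where "\<kappa> \<in> forest_labelings F" "\<And>j. lookup d j = card {v \<in> IN F. \<kappa> v = j}"
proof -
  obtain \<kappa> where \<kappa>: "\<kappa> \<in> forest_labelings F" "d \<in> keys (\<Prod>v\<in>IN F. X (\<kappa> v))"
    using assms(2) keys_sum[of "\<lambda>\<kappa>. \<Prod>v\<in>IN F. X (\<kappa> v)" "forest_labelings F"]
    unfolding forest_poly_def by blast
  then have "d = (\<Sum>v\<in>IN F. single (\<kappa> v) 1)"
    by (simp add: prod_X_eq_monomial monomial_def)
  then have "lookup d j = card {v \<in> IN F. \<kappa> v = j}" for j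
    using finite_IN[OF forest] by (simp add: lookup_sum lookup_single when_def sum.If_cases Int_def)
  with \<kappa>(1) that show thesis by blast
qed

lemma rho_in_keys_code:
  assumes forest: "indexed_forest_on S F" and "forest_code F = lookup c" "v \<in> IN F"
  shows "rho F v \<in> keys c"
proof -
  have "v \<in> {w \<in> IN F. rho F w = rho F v}" "finite {w \<in> IN F. rho F w = rho F v}"
    using assms finite_IN[OF forest] by auto
  then have "forest_code F (rho F v) \<noteq> 0"
    unfolding forest_code_def by (metis card_eq_0_iff empty_iff)
  then show ?thesis by (simp add: assms(2) in_keys_iff)
qed

lemma keys_forest_poly_subset_ABB:
  assumes forest: "indexed_forest_on S F" and code: "forest_code F = lookup c" and ABB: "c \<in> ABB n"
  shows "keys (forest_poly F) \<subseteq> ABB n"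
proof
  fix d assume "d \<in> keys (forest_poly F)"
  then obtain \<kappa> where "\<kappa> \<in> forest_labelings F" and d: "\<And>j. lookup d j = card {v \<in> IN F. \<kappa> v = j}"
    using keys_forest_polyE[OF forest] by blast
  then have \<kappa>: "1 \<le> \<kappa> v" "\<kappa> v \<le> rho F v" if "v \<in> IN F" for v
    using that by (auto simp: forest_labelings_def PiE_iff)
  have rho: "rho F v \<le> n" if "v \<in> IN F" for v
    using rho_in_keys_code[OF forest code that] ABB by (auto simp: ABB_iff)
  note fin = finite_IN[OF forest]
  have "keys d \<subseteq> {1..n}"
  proof
    fix j assume "j \<in> keys d"
    then obtain v where "v \<in> IN F" "\<kappa> v = j"
      using d[of j] by (auto simp: in_keys_iff card_eq_0_iff)
    then show "j \<in> {1..n}"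
      using \<kappa>[of v] rho[of v] by auto
  qed
  moreover have "(\<Sum>j=m..n. lookup d j) \<le> n - m" if m: "m \<in> {1..n}" for m
  proof -
    have "(\<Sum>j=m..n. lookup d j) = card {v \<in> IN F. \<kappa> v \<in> {m..n}}"
      unfolding d using fin by (rule sum_card_fibres) simp
    also have "\<dots> \<le> card {v \<in> IN F. rho F v \<in> {m..n}}"
      using fin \<kappa>(2) rho by (intro card_mono) (auto intro: order_trans)
    also have "\<dots> = (\<Sum>j=m..n. lookup c j)"
      by (simp add: sum_forest_code[OF forest] flip: code)
    also have "\<dots> \<le> n - m"
      using ABB m by (simp add: ABB_iff)
    finally show ?thesis .
  qed
  ultimately show "d \<in> ABB n" by (simp add: ABB_iff)
qed

lemma ABB_if_IN_below:
  assumes forest: "indexed_forest_on S F" and code: "forest_code F = lookup c"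
    and keys_c: "keys c \<subseteq> {1..n}" and below: "\<And>v. v \<in> IN F \<Longrightarrow> v < n"
  shows "c \<in> ABB n"
proof -
  have "(\<Sum>j=m..n. lookup c j) \<le> n - m" for m
  proof -
    have "(\<Sum>j=m..n. lookup c j) = card {v \<in> IN F. rho F v \<in> {m..n}}"
      by (simp add: sum_forest_code[OF forest] flip: code)
    also have "\<dots> \<le> card {m..<n}"
    proof (rule card_mono)
      show "{v \<in> IN F. rho F v \<in> {m..n}} \<subseteq> {m..<n}"
        using below rho_in_tree(2)[OF forest] by (fastforce simp: IN_def)
    qed simp
    finally show ?thesis by simp
  qed
  with keys_c show ?thesis by (simp add: ABB_iff)
qed


subsection \<open>Forests are determined by their codes\<close>

text \<open>
  The letter of a node is its label together with its code. Appending the letter \<open>(v, 0)\<close> before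
  incrementing the head also covers a node \<open>v\<close> without left child, whose code is at least 1.
\<close>

fun bump :: "('a \<times> nat) list \<Rightarrow> ('a \<times> nat) list" where
  "bump [] = []"
| "bump ((v, c) # w) = (v, Suc c) # w"

fun letters :: "'a tree \<Rightarrow> ('a \<times> nat) list" where
  "letters Leaf = []"
| "letters (Node l v r) = bump (letters l @ [(v, 0)]) @ letters r"

lemma map_fst_bump [simp]: "map fst (bump w) = map fst w"
  by (cases w rule: bump.cases) simp_all

lemma bump_append: "u \<noteq> [] \<Longrightarrow> bump u @ w = bump (u @ w)"
  by (cases u rule: bump.cases) simp_all

lemma map_fst_letters: "map fst (letters t) = inorder t"
  by (induction t) simp_all

lemma bump_map:
  assumes "distinct xs" "xs \<noteq> []"
  shows "bump (map (\<lambda>i. (i, f i)) xs) = map (\<lambda>i. (i, f i + (if i = hd xs then 1 else 0))) xs"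
  using assms by (cases xs) auto

definition fibre_card :: "('a \<Rightarrow> 'b) \<Rightarrow> 'a tree \<Rightarrow> 'b \<Rightarrow> nat" where
  "fibre_card f t i = card {v \<in> set_tree t. f v = i}"

lemma fibre_card_Node:
  assumes "distinct (inorder (Node l a r))"
  shows "fibre_card f (Node l a r) i = fibre_card f l i + fibre_card f r i + (if i = f a then 1 else 0)"
proof -
  let ?A = "{v \<in> set_tree l. f v = i}" and ?B = "{v \<in> set_tree r. f v = i}"
    and ?C = "if i = f a then {a} else {}"
  have "{v \<in> set_tree (Node l a r). f v = i} = (?A \<union> ?B) \<union> ?C"
    by auto
  moreover have "card ((?A \<union> ?B) \<union> ?C) = card (?A \<union> ?B) + card ?C"
    using assms by (intro card_Un_disjoint) auto
  moreover have "card (?A \<union> ?B) = card ?A + card ?B"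
    using assms by (intro card_Un_disjoint) auto
  ultimately show ?thesis
    unfolding fibre_card_def by simp
qed

lemma fibre_card_leftmost_eq_0:
  assumes "\<And>l v r. Node l v r \<in> subtrees t \<Longrightarrow> f v = leftmost (Node l v r)" and "i \<notin> set_tree t"
  shows "fibre_card f t i = 0"
proof -
  have "f v \<in> set_tree t" if v: "v \<in> set_tree t" for v
  proof -
    obtain l r where sub: "Node l v r \<in> subtrees t"
      using set_treeE[OF v] by blast
    then show ?thesis
      using assms(1)[OF sub] leftmost_Node_in[of l v r] set_subtree[OF sub] by auto
  qed
  then show ?thesis
    using assms(2) by (auto simp: fibre_card_def)
qed

lemma letters_eq_map_fibre_card:
  assumes "distinct (inorder t)" "\<And>l v r. Node l v r \<in> subtrees t \<Longrightarrow> f v = leftmost (Node l v r)"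
  shows "letters t = map (\<lambda>i. (i, fibre_card f t i)) (inorder t)"
  using assms
proof (induction t)
  case (Node l a r)
  let ?t = "Node l a r" and ?xs = "inorder l @ [a]"
  have "f a = hd ?xs"
    using Node.prems(2)[of l a r] by (simp add: leftmost_eq_hd hd_append)
  then have card_Node: "fibre_card f ?t i =
      fibre_card f l i + fibre_card f r i + (if i = hd ?xs then 1 else 0)" for i
    by (simp add: fibre_card_Node[OF Node.prems(1)])
  have card_l: "fibre_card f l i = 0" if "i \<notin> set_tree l" for i
    using Node.prems(2) that by (intro fibre_card_leftmost_eq_0) auto
  have card_r: "fibre_card f r i = 0" if "i \<notin> set_tree r" for i
    using Node.prems(2) that by (intro fibre_card_leftmost_eq_0) auto
  have disjoint: "i \<notin> set_tree r" if "i \<in> set ?xs" for i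
    using that Node.prems(1) by auto
  have "letters l = map (\<lambda>i. (i, fibre_card f l i)) (inorder l)"
    "letters r = map (\<lambda>i. (i, fibre_card f r i)) (inorder r)"
    using Node by auto
  then have "letters ?t =
      bump (map (\<lambda>i. (i, fibre_card f l i)) ?xs) @ map (\<lambda>i. (i, fibre_card f r i)) (inorder r)"
    using Node.prems(1) by (simp add: card_l)
  also have "bump (map (\<lambda>i. (i, fibre_card f l i)) ?xs) = map (\<lambda>i. (i, fibre_card f ?t i)) ?xs"
    using Node.prems(1) disjoint by (subst bump_map) (simp_all add: card_Node card_r)
  also have "map (\<lambda>i. (i, fibre_card f r i)) (inorder r) = map (\<lambda>i. (i, fibre_card f ?t i)) (inorder r)"
  proof (rule map_cong)
    fix i assume "i \<in> set (inorder r)"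
    then have "i \<notin> set ?xs" using disjoint by auto
    then show "(i, fibre_card f r i) = (i, fibre_card f ?t i)"
      using hd_in_set[of ?xs] by (auto simp: card_Node card_l)
  qed simp
  finally show ?case by simp
qed simp

lemma letters_eq_map_forest_code:
  assumes forest: "indexed_forest_on S F" and T_in: "T \<in> F"
  shows "letters T = map (\<lambda>i. (i, forest_code F i)) (inorder T)"
proof -
  have "letters T = map (\<lambda>i. (i, fibre_card (rho F) T i)) (inorder T)"
    using indexed_forest_on_distinct[OF forest T_in] rho_eq_leftmost[OF forest T_in]
    by (intro letters_eq_map_fibre_card)
  also have "\<dots> = map (\<lambda>i. (i, forest_code F i)) (inorder T)"
  proof (rule map_cong)
    fix i assume "i \<in> set (inorder T)"
    then have "v \<in> set_tree T" if "v \<in> IN F" "rho F v = i" for v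
      using that rho_in_tree(1)[OF forest] indexed_forest_on_disjoint[OF forest T_in]
      by (auto simp: IN_def)
    then have "{v \<in> set_tree T. rho F v = i} = {v \<in> IN F. rho F v = i}"
      using T_in by (auto simp: IN_def)
    then show "(i, fibre_card (rho F) T i) = (i, forest_code F i)"
      by (simp add: fibre_card_def forest_code_def)
  qed simp
  finally show ?thesis .
qed

lemma forest_code_eq_0:
  assumes forest: "indexed_forest_on S F" and "i \<notin> S"
  shows "forest_code F i = 0"
proof -
  have "rho F v \<noteq> i" if "v \<in> IN F" for v
    using that \<open>i \<notin> S\<close> rho_in_tree(1)[OF forest] IN_subset_support[OF forest] by (auto simp: IN_def)
  then have "{v \<in> IN F. rho F v = i} = {}" by blast
  then show ?thesis unfolding forest_code_def by (simp only: card.empty)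
qed

text \<open>
  A row \<open>(t, [(v\<^sub>1, t\<^sub>1), \<dots>, (v\<^sub>k, t\<^sub>k)])\<close> lists trees \<open>t, t\<^sub>1, \<dots>, t\<^sub>k\<close> separated by
  single labels \<open>v\<^sub>1, \<dots>, v\<^sub>k\<close>, which get the code 0.
\<close>

type_synonym 'a row = "'a tree \<times> ('a \<times> 'a tree) list"

fun row_letters :: "'a row \<Rightarrow> ('a \<times> nat) list" where
  "row_letters (t, []) = letters t"
| "row_letters (t, (v, r) # ws) = letters t @ (v, 0) # row_letters (r, ws)"

fun row_trees :: "'a row \<Rightarrow> 'a tree set" where
  "row_trees (t, ws) = insert t (snd ` set ws)"

fun separators :: "'a row \<Rightarrow> 'a set" where
  "separators (t, ws) = fst ` set ws"

definition row_labels :: "'a row \<Rightarrow> 'a list" where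
  "row_labels s = map fst (row_letters s)"

lemma row_labels_simps [simp]:
  "row_labels (t, []) = inorder t"
  "row_labels (t, (v, r) # ws) = inorder t @ v # row_labels (r, ws)"
  by (simp_all add: row_labels_def map_fst_letters)

lemma set_row_labels: "set (row_labels s) = (\<Union>T\<in>row_trees s. set_tree T) \<union> separators s"
  by (induction s rule: row_letters.induct) auto

text \<open>
  Reading the letters from right to left, a letter \<open>(v, c)\<close> turns \<open>v\<close> into a separator and then
  grafts \<open>c\<close> times: the first tree becomes the left subtree of the first separator.
\<close>

fun graft :: "'a row \<Rightarrow> 'a row" where
  "graft (t, []) = (t, [])"
| "graft (t, (v, r) # ws) = (Node t v r, ws)"

fun push :: "'a \<times> nat \<Rightarrow> 'a row \<Rightarrow> 'a row" where
  "push (v, c) (t, ws) = (graft ^^ c) (Leaf, (v, t) # ws)"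

definition read_row :: "('a \<times> nat) list \<Rightarrow> 'a row" where
  "read_row w = foldr push w (Leaf, [])"

lemma foldr_push_bump: "w \<noteq> [] \<Longrightarrow> foldr push (bump w) s = graft (foldr push w s)"
  by (cases w rule: bump.cases; cases "foldr push (tl w) s") simp_all

lemma foldr_push_letters: "foldr push (letters t) (Leaf, ws) = (t, ws)"
  by (induction t arbitrary: ws) (simp_all add: foldr_push_bump)

lemma read_row_letters: "read_row (row_letters s) = s"
  unfolding read_row_def
  by (induction s rule: row_letters.induct) (simp_all add: foldr_push_letters)

lemma row_letters_graft: "ws \<noteq> [] \<Longrightarrow> row_letters (graft (t, ws)) = bump (row_letters (t, ws))"
  by (cases ws rule: list.exhaust; cases "tl ws") (auto simp: bump_append)

lemma row_letters_graft_funpow: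
  assumes "c \<le> Suc (length ws)"
  shows "row_letters ((graft ^^ c) (Leaf, (v, t) # ws)) = (v, c) # row_letters (t, ws) \<and>
    length (snd ((graft ^^ c) (Leaf, (v, t) # ws))) + c = Suc (length ws)"
  using assms
proof (induction c)
  case (Suc c)
  obtain u us where u: "(graft ^^ c) (Leaf, (v, t) # ws) = (u, us)" by fastforce
  with Suc have IH: "row_letters (u, us) = (v, c) # row_letters (t, ws)"
    "length us + c = Suc (length ws)"
    by simp_all
  with Suc.prems have "us \<noteq> []" by auto
  then have "length us = Suc (length (snd (graft (u, us))))"
    by (cases us) auto
  then show ?case
    using row_letters_graft[OF \<open>us \<noteq> []\<close>, of u] u IH by simp
qed simp

lemma row_letters_read_row:
  assumes "\<And>u v. w = u @ v \<Longrightarrow> sum_list (map snd v) \<le> length v"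
  shows "row_letters (read_row w) = w"
proof -
  have "row_letters (read_row w) = w \<and> length (snd (read_row w)) + sum_list (map snd w) = length w"
    using assms
  proof (induction w)
    case (Cons x w)
    obtain v c where x: "x = (v, c)" by fastforce
    obtain t ws where t: "read_row w = (t, ws)" by fastforce
    have IH: "row_letters (t, ws) = w" "length ws + sum_list (map snd w) = length w"
      using Cons.IH Cons.prems[of "x # u" for u] by (simp_all add: t)
    have "c \<le> Suc (length ws)"
      using Cons.prems[of "[]" "x # w"] IH(2) by (simp add: x)
    moreover have "read_row (x # w) = (graft ^^ c) (Leaf, (v, t) # ws)"
      using t by (simp add: x read_row_def)
    ultimately show ?case
      using row_letters_graft_funpow[of c ws v t] IH by (simp add: x)
  qed (simp add: read_row_def)
  then show ?thesis ..
qed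

lemma row_trees_disjoint:
  assumes "distinct (row_labels s)" "T \<in> row_trees s" "T' \<in> row_trees s"
    and "x \<in> set_tree T" "x \<in> set_tree T'"
  shows "T = T'"
  using assms
proof (induction s rule: row_letters.induct[case_names single cons])
  case (cons t v r ws)
  have "row_trees (t, (v, r) # ws) = insert t (row_trees (r, ws))"
    by simp
  moreover have "x \<in> set (row_labels (r, ws))" if "U \<in> row_trees (r, ws)" "x \<in> set_tree U" for U
    using that by (auto simp: set_row_labels)
  moreover have "x \<notin> set (row_labels (r, ws))" if "x \<in> set_tree t"
    using that cons.prems(1) by auto
  ultimately show ?case
    using cons by auto
qed simp

lemma separators_disjoint:
  assumes "distinct (row_labels s)" "T \<in> row_trees s"
  shows "separators s \<inter> set_tree T = {}"
  using assms
proof (induction s rule: row_letters.induct[case_names single cons])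
  case (cons t v r ws)
  have "separators (t, (v, r) # ws) = insert v (separators (r, ws))"
    "row_trees (t, (v, r) # ws) = insert t (row_trees (r, ws))"
    by simp_all
  then show ?case
    using cons by (auto simp: set_row_labels disjoint_iff)
qed simp

lemma inorder_upt_in_blocks:
  assumes "inorder T = [a..<b]" "T \<noteq> Leaf" "set_tree T \<subseteq> S" "a - 1 \<notin> S" "b \<notin> S"
  shows "set_tree T \<in> blocks S" "inorder T = sorted_list_of_set (set_tree T)"
proof -
  show "inorder T = sorted_list_of_set (set_tree T)"
    using inorder_uptD[OF assms(1)] assms(1) by simp
  have "a < b"
    using assms(1,2) by (metis eq_inorder_Nil not_le upt_conv_Nil)
  then show "set_tree T \<in> blocks S"
    using assms(3-5) unfolding inorder_uptD(1)[OF assms(1)] by (rule atLeastLessThan_in_blocks)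
qed

lemma row_tree_in_blocks:
  assumes "row_labels s = [a..<b]" "a - 1 \<notin> S" "b \<notin> S" "separators s \<inter> S = {}"
    and "\<And>T. T \<in> row_trees s \<Longrightarrow> set_tree T \<subseteq> S" and "T \<in> row_trees s" "T \<noteq> Leaf"
  shows "set_tree T \<in> blocks S \<and> inorder T = sorted_list_of_set (set_tree T)"
  using assms
proof (induction s arbitrary: a rule: row_letters.induct[case_names single cons])
  case (single t)
  then show ?case using inorder_upt_in_blocks[of t a b S] by simp
next
  case (cons t v r ws)
  have "[a..<b] = inorder t @ v # row_labels (r, ws)"
    using cons.prems(1) by simp
  note split = upt_eq_append_Cons[OF this]
  have "v \<notin> S"
    using cons.prems(4) by auto
  show ?case
  proof (cases "T = t")
    case True
    then show ?thesis
      using inorder_upt_in_blocks[OF split(3), of S] cons.prems(2,5,7) \<open>v \<notin> S\<close> by simp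
  next
    case False
    then show ?thesis
      using cons.prems \<open>v \<notin> S\<close> split(2) by (intro cons.IH[of "Suc v"]) auto
  qed
qed

lemma indexed_forest_on_row:
  assumes "row_labels s = [1..<b]"
  shows "indexed_forest_on (\<Union>T\<in>row_trees s. set_tree T) (row_trees s - {Leaf})"
proof -
  let ?S = "\<Union>T\<in>row_trees s. set_tree T" and ?F = "row_trees s - {Leaf}"
  have distinct: "distinct (row_labels s)"
    by (simp add: assms)
  have support: "?S \<subseteq> {1..<b}"
    using arg_cong[OF assms, of set] by (auto simp: set_row_labels)
  have "?S \<inter> separators s = {}"
    using separators_disjoint[OF distinct] by blast
  then have block: "set_tree T \<in> blocks ?S \<and> inorder T = sorted_list_of_set (set_tree T)"
    if "T \<in> ?F" for T
    using that support by (intro row_tree_in_blocks[OF assms]) auto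
  have "inj_on set_tree ?F"
  proof (rule inj_onI)
    fix T T' assume T: "T \<in> ?F" "T' \<in> ?F" and eq: "set_tree T = set_tree T'"
    then obtain x where "x \<in> set_tree T" by (cases T) auto
    then show "T = T'" using T eq row_trees_disjoint[OF distinct, of T T' x] by simp
  qed
  moreover have "set_tree ` ?F = blocks ?S"
  proof (intro equalityI subsetI)
    fix I assume I: "I \<in> blocks ?S"
    then have "I \<noteq> {}" "I \<subseteq> ?S" by (auto simp: blocks_def)
    then obtain x where "x \<in> I" "x \<in> ?S" by blast
    then obtain T where "T \<in> row_trees s" and T: "x \<in> set_tree T" by blast
    then have "T \<in> ?F" by auto
    then show "I \<in> set_tree ` ?F"
      using blocks_disjoint[OF I _ \<open>x \<in> I\<close> T] block by blast
  qed (use block in auto)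
  moreover have "finite ?S" "?S \<subseteq> {1..}"
    using support by (auto intro: finite_subset)
  ultimately show ?thesis
    using block by (simp add: indexed_forest_on_def bij_betw_def)
qed

lemma block_starting_at:
  assumes "finite S" "m \<in> S" "m - 1 \<notin> S"
  obtains e where "m < e" "e \<notin> S" "{m..<e} \<in> blocks S"
proof -
  define e where "e = (LEAST e. m < e \<and> e \<notin> S)"
  obtain k where "\<forall>i\<in>S. i < k"
    using assms(1) finite_nat_set_iff_bounded by blast
  then have "\<exists>e>m. e \<notin> S"
    using assms(2) by blast
  then have e: "m < e \<and> e \<notin> S"
    unfolding e_def by (rule LeastI_ex)
  have "i \<in> S" if "m \<le> i" "i < e" for i
    using not_less_Least[of i "\<lambda>e. m < e \<and> e \<notin> S"] that assms(2) by (cases "i = m") (auto simp: e_def)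
  then have "{m..<e} \<in> blocks S"
    using e assms(3) by (intro atLeastLessThan_in_blocks) auto
  with that e show thesis by blast
qed

lemma forest_tree_starting_at:
  assumes forest: "indexed_forest_on S F" and support_bound: "S \<subseteq> {..<b}" and "m - 1 \<notin> S" "m \<le> b"
  obtains T e where "T \<in> insert Leaf F" "inorder T = [m..<e]" "m \<le> e" "e \<le> b" "e \<notin> S"
proof (cases "m \<in> S")
  case False
  then show thesis using that[of Leaf m] assms(4) by simp
next
  case True
  obtain e where e: "m < e" "e \<notin> S" "{m..<e} \<in> blocks S"
    using block_starting_at[of S m] forest True assms(3) by (auto simp: indexed_forest_on_def)
  then have "{m..<e} \<in> set_tree ` F"
    using forest by (simp add: indexed_forest_on_def bij_betw_def)
  then obtain T where T: "T \<in> F" "set_tree T = {m..<e}"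
    by (metis imageE)
  then have "inorder T = [m..<e]"
    using forest by (simp add: indexed_forest_on_def)
  moreover have "e - 1 \<in> S"
    using T e(1) IN_subset_support[OF forest] by (fastforce simp: IN_def)
  then have "e \<le> b" using support_bound by auto
  ultimately show thesis using that[of T e] T(1) e by simp
qed

lemma forest_row_exists:
  assumes forest: "indexed_forest_on S F" and support_bound: "S \<subseteq> {..<b}" and "m - 1 \<notin> S" "m \<le> b"
  shows "\<exists>s. row_labels s = [m..<b] \<and> row_trees s \<subseteq> insert Leaf F \<and> separators s \<inter> S = {}"
  using assms(3,4)
proof (induction "b - m" arbitrary: m rule: less_induct)
  case less
  obtain T e where T: "T \<in> insert Leaf F" "inorder T = [m..<e]" and e: "m \<le> e" "e \<le> b" "e \<notin> S"
    using forest_tree_starting_at[OF forest support_bound less.prems] .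
  consider (last) "e = b" | (separator) "e < b" using e(2) by linarith
  then show ?case
  proof cases
    case last
    then show ?thesis
      using T by (intro exI[of _ "(T, [])"]) auto
  next
    case separator
    then have "\<exists>s. row_labels s = [Suc e..<b] \<and> row_trees s \<subseteq> insert Leaf F \<and> separators s \<inter> S = {}"
      using e by (intro less.hyps) auto
    then obtain t ws where "row_labels (t, ws) = [Suc e..<b]" "row_trees (t, ws) \<subseteq> insert Leaf F"
      "separators (t, ws) \<inter> S = {}"
      by (metis surj_pair)
    moreover have "[m..<b] = [m..<e] @ e # [Suc e..<b]"
      using e(1) separator by (metis le_add_diff_inverse less_imp_le upt_add_eq_append upt_conv_Cons)
    ultimately show ?thesis
      using T e by (intro exI[of _ "(T, (e, t) # ws)"]) auto
  qed
qed

lemma row_letters_eq_map_forest_code: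
  assumes forest: "indexed_forest_on S F"
  shows "row_trees s \<subseteq> insert Leaf F \<Longrightarrow> separators s \<inter> S = {} \<Longrightarrow>
    row_letters s = map (\<lambda>i. (i, forest_code F i)) (row_labels s)"
proof (induction s rule: row_letters.induct[case_names single cons])
  case (single t)
  then show ?case using letters_eq_map_forest_code[OF forest] by auto
next
  case (cons t v r ws)
  have "letters t = map (\<lambda>i. (i, forest_code F i)) (inorder t)"
    using cons.prems(1) letters_eq_map_forest_code[OF forest] by (cases "t = Leaf") auto
  moreover have "forest_code F v = 0"
    using cons.prems(2) forest_code_eq_0[OF forest] by auto
  ultimately show ?case
    using cons by simp
qed

lemma indexed_forest_eq_read_row:
  assumes forest: "indexed_forest_on S F" and support_bound: "S \<subseteq> {..<b}" and "1 \<le> b"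
  shows "F = row_trees (read_row (map (\<lambda>i. (i, forest_code F i)) [1..<b])) - {Leaf}"
proof -
  have "0 \<notin> S"
    using forest by (auto simp: indexed_forest_on_def)
  then obtain s where s: "row_labels s = [1..<b]" "row_trees s \<subseteq> insert Leaf F" "separators s \<inter> S = {}"
    using forest_row_exists[OF forest support_bound, of 1] \<open>1 \<le> b\<close> by auto
  have "F = row_trees s - {Leaf}"
  proof (intro equalityI subsetI)
    fix T assume T: "T \<in> F"
    then obtain x where x: "x \<in> set_tree T"
      using indexed_forest_on_tree[OF forest T]
      by (metis atLeastLessThan_iff inorder_uptD(1) order_refl)
    then have "x \<in> S"
      using T IN_subset_support[OF forest] by (auto simp: IN_def)
    then have "x \<in> set (row_labels s)" "x \<notin> separators s"
      using support_bound \<open>0 \<notin> S\<close> s by (auto intro: Suc_leI gr0I)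
    then obtain T' where T': "T' \<in> row_trees s" "x \<in> set_tree T'"
      by (auto simp: set_row_labels)
    then have "T' \<in> F" using s(2) by auto
    then have "T = T'" using indexed_forest_on_disjoint[OF forest T _ x] T' by blast
    with T' show "T \<in> row_trees s - {Leaf}" by auto
  next
    fix T assume "T \<in> row_trees s - {Leaf}"
    with s(2) show "T \<in> F" by blast
  qed
  also have "s = read_row (map (\<lambda>i. (i, forest_code F i)) [1..<b])"
    using row_letters_eq_map_forest_code[OF forest s(2,3)] read_row_letters[of s] s(1) by simp
  finally show ?thesis .
qed

lemma forest_code_inj:
  assumes forest: "indexed_forest_on S F" and forest': "indexed_forest_on S' F'"
    and code: "forest_code F = forest_code F'"
  shows "F = F'"
proof -
  have "finite (S \<union> S')"
    using forest forest' by (simp add: indexed_forest_on_def)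
  then obtain b where "\<forall>i\<in>S \<union> S'. i < b"
    using finite_nat_set_iff_bounded by blast
  then have "S \<subseteq> {..<Suc b}" "S' \<subseteq> {..<Suc b}"
    by (auto intro: less_SucI)
  then show ?thesis
    using indexed_forest_eq_read_row[OF forest, of "Suc b"]
      indexed_forest_eq_read_row[OF forest', of "Suc b"] code
    by simp
qed

lemma row_letters_read_row_code:
  assumes support_c: "\<And>i. c i \<noteq> 0 \<Longrightarrow> i \<in> {1..n}" and b: "b = Suc n + (\<Sum>i=1..n. c i)"
  shows "row_letters (read_row (map (\<lambda>i. (i, c i)) [1..<b])) = map (\<lambda>i. (i, c i)) [1..<b]"
proof (rule row_letters_read_row)
  fix u v assume "map (\<lambda>i. (i, c i)) [1..<b] = u @ v"
  then have v: "v = map (\<lambda>i. (i, c i)) [Suc (length u)..<b]"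
    by (metis append_eq_conv_conj drop_map drop_upt plus_1_eq_Suc)
  have "sum_list (map snd v) = (\<Sum>i=Suc (length u)..<b. c i)"
    by (simp add: v comp_def sum_list_distinct_conv_sum_set)
  also have "\<dots> = (\<Sum>i\<in>{Suc (length u)..<b} \<inter> {1..n}. c i)"
    using support_c by (intro sum.mono_neutral_right) auto
  also have "\<dots> \<le> b - Suc (length u)"
  proof (cases "n < Suc (length u)")
    case True
    then have "{Suc (length u)..<b} \<inter> {1..n} = {}" by auto
    then show ?thesis by (simp only: sum.empty)
  next
    case False
    have "(\<Sum>i\<in>{Suc (length u)..<b} \<inter> {1..n}. c i) \<le> (\<Sum>i=1..n. c i)"
      by (intro sum_mono2) auto
    then show ?thesis using False by (simp add: b)
  qed
  finally show "sum_list (map snd v) \<le> length v"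
    by (simp add: v)
qed

lemma forest_code_surj:
  assumes support_c: "\<And>i. c i \<noteq> 0 \<Longrightarrow> i \<in> {1..n}"
  shows "\<exists>S F. indexed_forest_on S F \<and> forest_code F = c"
proof -
  define b where "b = Suc n + (\<Sum>i=1..n. c i)"
  define s where "s = read_row (map (\<lambda>i. (i, c i)) [1..<b])"
  let ?S = "\<Union>T\<in>row_trees s. set_tree T" and ?F = "row_trees s - {Leaf}"
  have letters: "row_letters s = map (\<lambda>i. (i, c i)) [1..<b]"
    unfolding s_def using support_c b_def by (rule row_letters_read_row_code)
  then have labels: "row_labels s = [1..<b]"
    by (simp add: row_labels_def comp_def)
  then have forest: "indexed_forest_on ?S ?F"
    by (rule indexed_forest_on_row)
  have "separators s \<inter> ?S = {}"
    using separators_disjoint[of s] by (auto simp: labels)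
  then have "row_letters s = map (\<lambda>i. (i, forest_code ?F i)) [1..<b]"
    using row_letters_eq_map_forest_code[OF forest, of s] labels by auto
  with letters have code: "forest_code ?F i = c i" if "i \<in> {1..<b}" for i
    using that by simp
  have "forest_code ?F i = c i" for i
  proof (cases "i \<in> {1..<b}")
    case False
    then have "i \<notin> ?S"
      using arg_cong[OF labels, of set] by (auto simp: set_row_labels)
    moreover have "c i = 0"
      using False support_c[of i] by (force simp: b_def)
    ultimately show ?thesis using forest_code_eq_0[OF forest] by simp
  qed (rule code)
  with forest show ?thesis by blast
qed

lemma forest_of_code:
  assumes "keys c \<subseteq> {1..n}"
  obtains S where "indexed_forest_on S (forest_of c)" "forest_code (forest_of c) = lookup c"
proof -
  have "i \<in> {1..n}" if "lookup c i \<noteq> 0" for i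
    using that assms in_keys_iff[of i c] by auto
  then obtain S F where forest: "indexed_forest_on S F" "forest_code F = lookup c"
    using forest_code_surj[of "lookup c" n] by blast
  have "forest_of c = F"
    unfolding forest_of_def indexed_forest_def
  proof (rule the_equality)
    show "(\<exists>S. indexed_forest_on S F) \<and> forest_code F = lookup c" using forest by blast
    show "F' = F" if "(\<exists>S. indexed_forest_on S F') \<and> forest_code F' = lookup c" for F'
      using that forest forest_code_inj by metis
  qed
  with forest that show thesis by blast
qed

theorem theorem1p5:
  fixes n :: nat and c :: "nat \<Rightarrow>\<^sub>0 nat"
  assumes "n \<ge> 1"
    and "Poly_Mapping.keys c \<subseteq> {1..n}"
  shows "reduction n (forest_poly_code c) =
           (if c \<in> ABB n then forest_poly_code c else 0)"
proof -
  obtain S where forest: "indexed_forest_on S (forest_of c)"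
    and code: "forest_code (forest_of c) = lookup c"
    using forest_of_code[OF assms(2)] .
  show ?thesis
  proof (cases "c \<in> ABB n")
    case True
    then have "keys (forest_poly_code c) \<subseteq> ABB n"
      unfolding forest_poly_code_def by (rule keys_forest_poly_subset_ABB[OF forest code])
    with True show ?thesis by (simp add: reduction_eqI QSym_plus_0)
  next
    case False
    then obtain v where "v \<in> IN (forest_of c)" "n \<le> v"
      using ABB_if_IN_below[OF forest code assms(2)] not_less by blast
    moreover have "rho (forest_of c) w \<le> n" if "w \<in> IN (forest_of c)" for w
      using rho_in_keys_code[OF forest code that] assms(2) by auto
    ultimately have "forest_poly_code c \<in> QSym_plus n"
      unfolding forest_poly_code_def by (intro forest_poly_in_QSym_plus[OF forest])
    with False show ?thesis by (simp add: reduction_eqI)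
  qed
qed

end
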